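(* Let $(\Delta,w')$ be a finite weighted rooted tree of the type described in the context, and let $\Gamma=\operatorname{sg}(\Delta)$ be its semigroup. Then $$2\delta(\Gamma)\le\mu(\Delta),$$ with equality if and only if $(\Delta,w')$ satisfies the semigroup condition, in which case $\Gamma=\operatorname{sg}(\Delta)$ is a complete intersection semigroup. The same result holds with $2\delta(\Gamma)$ replaced by $c(\Gamma)$: $c(\Gamma)\le\mu(\Delta)$, with equality if and only if $(\Delta,w')$ satisfies the semigroup condition, in which case $\Gamma$ is a complete intersection semigroup.
   Context: $\mathbb N=\{0,1,2,\dots\}$. A numeric semigroup is a subsemigroup $\Gamma\subseteq\mathbb N$ (containing $0$) with $\mathbb N-\Gamma$ finite. Its conductor $c(\Gamma)$ is the smallest $c\ge0$ such that $\gamma\ge c$ implies $\gamma\in\Gamma$; $\delta(\Gamma)$ is the number of gaps (elements of $\mathbb N-\Gamma$). $\Gamma$ is a complete intersection semigroup if the graded subalgebra $\mathbb C[t^\Gamma]\subseteq\mathbb C[t]$ generated by $t^\gamma$, $\gamma\in\Gamma$, is a graded complete intersection. The weighted rooted trees $(\Delta,w')$: $\Delta$ is a finite tree with a distinguished root vertex $w'$ of valency $1$; "downward" means away from the root. All edges other than the root edge (the edge at $w'$) carry positive integer weights, and the weights on the downward edges at each non-root vertex are pairwise coprime. Leaves are vertices of valency $1$ other than $w'$. For a vertex $v\ne w'$, $\ell_{w'v}$ is the product of the weights on edges directly adjacent to, but not on, the shortest path from $w'$ to $v$ (empty product $=1$). The semigroup of $(\Delta,w')$ is $\operatorname{sg}(\Delta)=\operatorname{sg}(\Delta,w'):=\mathbb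 N\langle\ell_{w'w}: w\text{ a leaf of }\Delta\rangle$, the semigroup generated by these numbers. Each downward edge $e$ at a non-root vertex $v$ cuts off a subtree below $v$, with root vertex $v$ and root edge $e$; $(\Delta,w')$ satisfies the semigroup condition if for every such subtree the weight of its root edge $e$ belongs to the semigroup of that subtree. Finally, $$\mu(\Delta)=\mu(\Delta,w'):=1+\sum_{v\ne w'}(\delta_v-2)\ell_{w'v},$$ the sum over all vertices $v\neq w'$, where $\delta_v$ is the valency of $v$.
   Formalization: The direction "equality implies the semigroup condition" is stated only for trees without vertices of valency 2; it fails otherwise, e.g. w'–v–(weight 1)–u with two leaves at u on edges of weights 2 and 3. *)

theory Defs
  imports
    Complex_Main
    "HOL-Algebra.Ideal"
    "HOL-Computational_Algebra.Polynomial"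
    "HOL-Library.Poly_Mapping"
begin

section \<open>Weighted rooted trees\<close>

text \<open>
  Edges are two-element sets of vertices. The weight function is total, but its value at the edge
  at the root vertex is never used.
\<close>

record 'a wtree =
  vertices :: "'a set"
  edges :: "'a set set"
  root_vertex :: 'a
  weight :: "'a set \<Rightarrow> nat"

definition valency :: "'a wtree \<Rightarrow> 'a \<Rightarrow> nat" where
  "valency \<Delta> v = card {e \<in> edges \<Delta>. v \<in> e}"

text \<open>Paths are given by their lists of vertices.\<close>

definition is_path :: "'a wtree \<Rightarrow> 'a \<Rightarrow> 'a list \<Rightarrow> 'a \<Rightarrow> bool" where
  "is_path \<Delta> u p v \<longleftrightarrow> p \<noteq> [] \<and> hd p = u \<and> last p = v \<and> set p \<subseteq> vertices \<Delta> \<and> distinct p \<and>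
     (\<forall>i. Suc i < length p \<longrightarrow> {p ! i, p ! Suc i} \<in> edges \<Delta>)"

definition path_edges :: "'a list \<Rightarrow> 'a set set" where
  "path_edges p = {{p ! i, p ! Suc i} | i. Suc i < length p}"

definition shortest_path :: "'a wtree \<Rightarrow> 'a \<Rightarrow> 'a \<Rightarrow> 'a list" where
  "shortest_path \<Delta> u v = (ARG_MIN length p. is_path \<Delta> u p v)"

definition finite_tree :: "'a wtree \<Rightarrow> bool" where
  "finite_tree \<Delta> \<longleftrightarrow>
     finite (vertices \<Delta>) \<and> vertices \<Delta> \<noteq> {} \<and>
     (\<forall>e \<in> edges \<Delta>. e \<subseteq> vertices \<Delta> \<and> card e = 2) \<and>
     (\<forall>u \<in> vertices \<Delta>. \<forall>v \<in> vertices \<Delta>. \<exists>p. is_path \<Delta> u p v) \<and>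
     \<not> (\<exists>u v p. is_path \<Delta> u p v \<and> length p \<ge> 3 \<and> {v, u} \<in> edges \<Delta>)"

text \<open>Downward means away from the root: an edge at \<open>v\<close> is downward if the path from the root
  to \<open>v\<close> does not use it.\<close>

definition down_edges :: "'a wtree \<Rightarrow> 'a \<Rightarrow> 'a set set" where
  "down_edges \<Delta> v =
     {e \<in> edges \<Delta>. v \<in> e \<and> e \<notin> path_edges (shortest_path \<Delta> (root_vertex \<Delta>) v)}"

definition weighted_rooted_tree :: "'a wtree \<Rightarrow> bool" where
  "weighted_rooted_tree \<Delta> \<longleftrightarrow>
     finite_tree \<Delta> \<and>
     root_vertex \<Delta> \<in> vertices \<Delta> \<and> valency \<Delta> (root_vertex \<Delta>) = 1 \<and>
     (\<forall>e \<in> edges \<Delta>. root_vertex \<Delta> \<notin> e \<longrightarrow> weight \<Delta> e > 0) \<and>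
     (\<forall>v \<in> vertices \<Delta> - {root_vertex \<Delta>}.
        pairwise (\<lambda>e e'. coprime (weight \<Delta> e) (weight \<Delta> e')) (down_edges \<Delta> v))"

text \<open>A vertex of valency 2 changes neither the semigroup of the tree nor \<open>tree_mu\<close>, but the weight
  of its downward edge is subject to the semigroup condition. In the presence of such vertices the
  equality \<open>tree_mu \<Delta> = 2 * num_gaps (sg \<Delta>)\<close> therefore does not imply the semigroup condition.\<close>

definition no_valency_2 :: "'a wtree \<Rightarrow> bool" where
  "no_valency_2 \<Delta> \<longleftrightarrow> (\<forall>v \<in> vertices \<Delta>. valency \<Delta> v \<noteq> 2)"

definition leaves :: "'a wtree \<Rightarrow> 'a set" where
  "leaves \<Delta> = {v \<in> vertices \<Delta>. v \<noteq> root_vertex \<Delta> \<and> valency \<Delta> v = 1}"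

text \<open>The number \<open>\<ell>\<^sub>w\<^sub>'\<^sub>v\<close>, for \<open>v\<close> different from the root \<open>w'\<close>.\<close>

definition ell :: "'a wtree \<Rightarrow> 'a \<Rightarrow> nat" where
  "ell \<Delta> v =
     (let p = shortest_path \<Delta> (root_vertex \<Delta>) v in
      \<Prod>e \<in> {e \<in> edges \<Delta>. e \<inter> set p \<noteq> {} \<and> e \<notin> path_edges p}. weight \<Delta> e)"

definition tree_mu :: "'a wtree \<Rightarrow> int" where
  "tree_mu \<Delta> =
     1 + (\<Sum>v \<in> vertices \<Delta> - {root_vertex \<Delta>}. (int (valency \<Delta> v) - 2) * int (ell \<Delta> v))"

definition add_submonoid :: "nat set \<Rightarrow> bool" where
  "add_submonoid S \<longleftrightarrow> 0 \<in> S \<and> (\<forall>a \<in> S. \<forall>b \<in> S. a + b \<in> S)"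

definition sg :: "'a wtree \<Rightarrow> nat set" where
  "sg \<Delta> = add_submonoid hull (ell \<Delta> ` leaves \<Delta>)"

text \<open>The subtree cut off by a downward edge \<open>e\<close> at \<open>v\<close>: besides its root \<open>v\<close>, its vertices are
  those that are reached from the root of the tree through \<open>e\<close>.\<close>

definition subtree :: "'a wtree \<Rightarrow> 'a \<Rightarrow> 'a set \<Rightarrow> 'a wtree" where
  "subtree \<Delta> v e =
     (let V = insert v {x \<in> vertices \<Delta>.
                e \<in> path_edges (shortest_path \<Delta> (root_vertex \<Delta>) x)}
      in \<lparr>vertices = V, edges = {e' \<in> edges \<Delta>. e' \<subseteq> V}, root_vertex = v, weight = weight \<Delta>\<rparr>)"

definition semigroup_condition :: "'a wtree \<Rightarrow> bool" where
  "semigroup_condition \<Delta> \<longleftrightarrow>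
     (\<forall>v \<in> vertices \<Delta> - {root_vertex \<Delta>}. \<forall>e \<in> down_edges \<Delta> v.
        weight \<Delta> e \<in> sg (subtree \<Delta> v e))"


section \<open>Numeric semigroups\<close>

definition numeric_semigroup :: "nat set \<Rightarrow> bool" where
  "numeric_semigroup \<Gamma> \<longleftrightarrow> add_submonoid \<Gamma> \<and> finite (- \<Gamma>)"

definition conductor :: "nat set \<Rightarrow> nat" where
  "conductor \<Gamma> = (LEAST c. \<forall>\<gamma> \<ge> c. \<gamma> \<in> \<Gamma>)"

definition num_gaps :: "nat set \<Rightarrow> nat" where
  "num_gaps \<Gamma> = card (- \<Gamma>)"


section \<open>Graded complete intersections\<close>

definition regular_sequence :: "('a, 'm) ring_scheme \<Rightarrow> 'a list \<Rightarrow> bool" where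
  "regular_sequence R fs \<longleftrightarrow>
     set fs \<subseteq> carrier R \<and>
     (\<forall>i < length fs. \<forall>g \<in> carrier R.
        fs ! i \<otimes>\<^bsub>R\<^esub> g \<in> Idl\<^bsub>R\<^esub> (set (take i fs)) \<longrightarrow> g \<in> Idl\<^bsub>R\<^esub> (set (take i fs))) \<and>
     Idl\<^bsub>R\<^esub> (set fs) \<noteq> carrier R"

text \<open>A polynomial in the variables \<open>x\<^sub>0, x\<^sub>1, \<dots>\<close> is a finitely supported family of coefficients
  indexed by exponent vectors, which are themselves finitely supported; the product provided by
  the library for such families is convolution, that is, multiplication of polynomials.
  The ring \<open>mpoly_ring n\<close> is the polynomial ring over the complex numbers in the variables
  \<open>x\<^sub>i\<close> with \<open>i < n\<close>.\<close>

type_synonym cmpoly = "(nat \<Rightarrow>\<^sub>0 nat) \<Rightarrow>\<^sub>0 complex"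

definition mpoly_ring :: "nat \<Rightarrow> cmpoly ring" where
  "mpoly_ring n =
     \<lparr>carrier = {p. \<forall>m \<in> Poly_Mapping.keys p. Poly_Mapping.keys m \<subseteq> {..<n}},
      monoid.mult = (*), one = 1, ring.zero = 0, ring.add = (+)\<rparr>"

definition mpoly_eval :: "(nat \<Rightarrow> complex poly) \<Rightarrow> cmpoly \<Rightarrow> complex poly" where
  "mpoly_eval y p =
     (\<Sum>m \<in> Poly_Mapping.keys p.
        smult (Poly_Mapping.lookup p m)
          (\<Prod>i \<in> Poly_Mapping.keys m. y i ^ Poly_Mapping.lookup m i))"

definition weighted_homogeneous :: "(nat \<Rightarrow> nat) \<Rightarrow> cmpoly \<Rightarrow> bool" where
  "weighted_homogeneous d p \<longleftrightarrow>
     (\<exists>k. \<forall>m \<in> Poly_Mapping.keys p.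
        (\<Sum>i \<in> Poly_Mapping.keys m. Poly_Mapping.lookup m i * d i) = k)"

text \<open>A graded subalgebra \<open>A\<close> of \<open>\<complex>[t]\<close> is a graded complete intersection if it is isomorphic, as
  a graded algebra, to the quotient of a polynomial ring, graded by positive degrees \<open>d i\<close> of the
  variables, by the ideal generated by a regular sequence of homogeneous elements. A homomorphism
  of graded algebras from the polynomial ring to \<open>\<complex>[t]\<close> is the evaluation at elements \<open>y i\<close> that
  are homogeneous of degree \<open>d i\<close>, that is, scalar multiples of powers of \<open>t\<close>.\<close>

definition graded_complete_intersection :: "complex poly set \<Rightarrow> bool" where
  "graded_complete_intersection A \<longleftrightarrow>
     (\<exists>n d y fs.
        (\<forall>i < n. d i > 0 \<and> (\<exists>c. y i = monom c (d i))) \<and>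
        mpoly_eval y ` carrier (mpoly_ring n) = A \<and>
        (\<forall>f \<in> set fs. weighted_homogeneous d f) \<and>
        regular_sequence (mpoly_ring n) fs \<and>
        {p \<in> carrier (mpoly_ring n). mpoly_eval y p = 0} = Idl\<^bsub>mpoly_ring n\<^esub> (set fs))"

definition poly_subalgebra :: "complex poly set \<Rightarrow> bool" where
  "poly_subalgebra A \<longleftrightarrow>
     1 \<in> A \<and> (\<forall>p \<in> A. \<forall>q \<in> A. p + q \<in> A \<and> p * q \<in> A) \<and> (\<forall>c. \<forall>p \<in> A. smult c p \<in> A)"

definition semigroup_algebra :: "nat set \<Rightarrow> complex poly set" where
  "semigroup_algebra \<Gamma> = poly_subalgebra hull ((\<lambda>\<gamma>. monom 1 \<gamma>) ` \<Gamma>)"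

definition ci_semigroup :: "nat set \<Rightarrow> bool" where
  "ci_semigroup \<Gamma> \<longleftrightarrow> numeric_semigroup \<Gamma> \<and> graded_complete_intersection (semigroup_algebra \<Gamma>)"

end

theory Submission
  imports Defs
begin

text \<open>
  Cutting a tree at the neighbour of its root presents \<open>sg(\<Delta>)\<close> as \<open>\<Sum>\<^sub>i A\<^sub>i \<Gamma>\<^sub>i\<close>, where the \<open>\<Gamma>\<^sub>i\<close> are the
  semigroups of the subtrees, \<open>\<alpha>\<^sub>i\<close> are the weights of their root edges, and \<open>A\<^sub>i\<close> is the product of
  the \<open>\<alpha>\<^sub>j\<close> with \<open>j \<noteq> i\<close>. Adding one summand at a time, this is an iteration of the gluing
  \<open>bG + aH\<close> with \<open>a\<close>, \<open>b\<close> coprime. For it,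
  \<open>2\<delta>(bG + aH) \<le> (a - 1)(b - 1) + 2b\<delta>(G) + 2a\<delta>(H)\<close>, and equality forces \<open>a \<in> G\<close> and \<open>b \<in> H\<close>.
  Conversely, if \<open>a \<in> G\<close> and \<open>b \<in> H\<close>, the conductor \<open>c\<close> satisfies the corresponding equation. As
  \<open>c \<le> 2\<delta>\<close> always holds, both versions of the theorem follow by induction. For the last claim, if
  \<open>a \<in> G\<close> and \<open>b \<in> H\<close>, then \<open>\<complex>[t\<^bsup>bG+aH\<^esup>]\<close> is the quotient of \<open>\<complex>[s\<^sup>G] \<otimes> \<complex>[t\<^sup>H]\<close> by the single element
  \<open>s\<^sup>a - t\<^sup>b\<close>, which is not a zero divisor.
\<close>

section \<open>Gluing numeric semigroups\<close>

text \<open>The recursion is simplest for the Frobenius number F = c - 1, taken as -1 for \<nat>: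
  gluing gives F(bG + aH) = ab + bF(G) + aF(H). The number \<mu> - 1 obeys the same rule, and
  2\<delta> - 1 obeys it as an upper bound. This is the origin of the expressions 1 + ... - 1 below,
  and the reason for integer arithmetic. The obstacle is a vertex with a single child. There nothing
  is glued, so equality puts no constraint on the weight of the edge below it, and the semigroup
  condition follows only in the absence of such vertices. The complete intersection property is
  therefore derived from the numerical equality itself: at a single child, semigroup and \<mu> are
  those of the subtree, and with several children equality forces the memberships that gluing
  requires. On the algebraic side, the graded pieces of a semigroup algebra have dimension at most
  one. Membership in an ideal thus becomes the vanishing of sums of coefficients, degree by degree,
  and regularity can be checked in each degree.\<close>

definition glue :: "nat \<Rightarrow> nat \<Rightarrow> nat set \<Rightarrow> nat set \<Rightarrow> nat set" where
  "glue a b G H = {b * g + a * h | g h. g \<in> G \<and> h \<in> H}"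

lemma glue_commute: "glue a b G H = glue b a H G"
proof -
  have "glue a b G H \<subseteq> glue b a H G" for a b G H
  proof
    fix n assume "n \<in> glue a b G H"
    then obtain g h where "n = a * h + b * g" "g \<in> G" "h \<in> H" by (auto simp: glue_def add.commute)
    then show "n \<in> glue b a H G" by (auto simp: glue_def)
  qed
  then show ?thesis by blast
qed

lemma add_submonoidI:
  "0 \<in> S \<Longrightarrow> (\<And>a b. a \<in> S \<Longrightarrow> b \<in> S \<Longrightarrow> a + b \<in> S) \<Longrightarrow> add_submonoid S"
  by (simp add: add_submonoid_def)

lemma add_submonoid_glue:
  assumes "add_submonoid G" "add_submonoid H"
  shows "add_submonoid (glue a b G H)"
proof (rule add_submonoidI)
  show "0 \<in> glue a b G H" using assms by (auto simp: glue_def add_submonoid_def)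
  fix x y assume "x \<in> glue a b G H" "y \<in> glue a b G H"
  then obtain g h g' h' where "x = b * g + a * h" "y = b * g' + a * h'"
    "g \<in> G" "g' \<in> G" "h \<in> H" "h' \<in> H" by (auto simp: glue_def)
  then have "x + y = b * (g + g') + a * (h + h')" "g + g' \<in> G" "h + h' \<in> H"
    using assms by (auto simp: algebra_simps add_submonoid_def)
  then show "x + y \<in> glue a b G H" by (auto simp: glue_def)
qed

lemma add_submonoid_mult: "add_submonoid G \<Longrightarrow> g \<in> G \<Longrightarrow> k * g \<in> G"
  by (induction k) (auto simp: add_submonoid_def)

lemma conductor_le: "(\<And>n. n \<ge> c \<Longrightarrow> n \<in> G) \<Longrightarrow> conductor G \<le> c"
  unfolding conductor_def by (rule Least_le) auto

lemma ge_conductor: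
  assumes "numeric_semigroup G" "n \<ge> conductor G"
  shows "n \<in> G"
proof -
  from assms(1) have "finite (- G)" by (simp add: numeric_semigroup_def)
  then obtain k where k: "\<forall>x \<in> - G. x < k" using finite_nat_set_iff_bounded by blast
  have "\<forall>\<gamma> \<ge> conductor G. \<gamma> \<in> G"
    unfolding conductor_def by (rule LeastI[of _ k]) (use k in \<open>meson ComplI leD\<close>)
  with assms(2) show ?thesis by blast
qed

text \<open>Stated over the integers, so that for conductor 0 there is no such \<open>n\<close> and
  the claim is vacuous; otherwise \<open>n\<close> is the Frobenius number.\<close>

lemma pred_conductor_notin:
  assumes "numeric_semigroup G" "int n = int (conductor G) - 1"
  shows "n \<notin> G"
proof
  assume "n \<in> G"
  have "conductor G \<le> n"
  proof (rule conductor_le)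
    fix m assume "n \<le> m"
    then show "m \<in> G" using \<open>n \<in> G\<close> assms ge_conductor[of G m] by (cases "m = n") auto
  qed
  with assms(2) show False by simp
qed

lemma conductor_eqI:
  assumes "numeric_semigroup G" "int c = C" "\<And>n. int n \<ge> C \<Longrightarrow> n \<in> G" "\<And>n. int n = C - 1 \<Longrightarrow> n \<notin> G"
  shows "int (conductor G) = C"
proof (rule antisym)
  show "int (conductor G) \<le> C" using conductor_le[of c G] assms by auto
  show "C \<le> int (conductor G)"
  proof (rule ccontr)
    assume "\<not> ?thesis"
    then have "conductor G \<le> c - 1" "c \<ge> 1" using assms(2) by auto
    then show False using assms(4)[of "c - 1"] ge_conductor[OF assms(1), of "c - 1"] assms(2) by auto
  qed
qed

text \<open>The reflection \<open>x \<mapsto> c - 1 - x\<close> sends elements of the semigroup below the conductor to gaps.\<close>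

lemma conductor_le_twice_gaps:
  assumes "numeric_semigroup G"
  shows "conductor G \<le> 2 * num_gaps G"
proof -
  let ?c = "conductor G"
  have fin: "finite (- G)" and sub: "add_submonoid G"
    using assms by (auto simp: numeric_semigroup_def)
  have gaps: "- G \<subseteq> {..<?c}" using ge_conductor[OF assms] by (auto simp: not_le[symmetric])
  have "card ({..<?c} \<inter> G) \<le> card (- G)"
  proof (rule card_inj_on_le[OF _ _ fin])
    show "inj_on (\<lambda>x. ?c - 1 - x) ({..<?c} \<inter> G)" by (auto simp: inj_on_def)
    show "(\<lambda>x. ?c - 1 - x) ` ({..<?c} \<inter> G) \<subseteq> - G"
    proof clarsimp
      fix x assume x: "x < ?c" "x \<in> G" "?c - Suc x \<in> G"
      then have "x + (?c - Suc x) \<in> G" using sub unfolding add_submonoid_def by blast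
      moreover have "x + (?c - Suc x) = ?c - 1" using x(1) by simp
      ultimately have "?c - 1 \<in> G" by metis
      then show False using pred_conductor_notin[OF assms, of "?c - 1"] x(1) by auto
    qed
  qed
  moreover have "card {..<?c} = card ({..<?c} \<inter> G) + card (- G)"
  proof -
    have "{..<?c} = ({..<?c} \<inter> G) \<union> - G" using gaps by auto
    then show ?thesis
      using card_Un_disjoint[of "{..<?c} \<inter> G" "- G"] fin by auto
  qed
  ultimately show ?thesis by (simp add: num_gaps_def)
qed

text \<open>A Bezout solution may be shifted by multiples of \<open>a\<close>, so \<open>x\<close>
  fits into any window of \<open>a\<close> consecutive integers. The start \<open>l\<close> is left
  free: 0 serves Sylvester's reflection, the conductor of \<open>G\<close> serves
  \<open>glue_large\<close>.\<close>

lemma coprime_representation: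
  fixes a b :: nat and n l :: int
  assumes "coprime a b" "a > 0"
  obtains x y :: int where "n = int b * x + int a * y" "l \<le> x" "x < l + int a"
proof -
  obtain u v where uv: "u * int b + v * int a = 1"
    using bezout_int[of "int b" "int a"] assms(1) by (auto simp: coprime_iff_gcd_eq_1 gcd.commute)
  define x where "x = l + (n * u - l) mod int a"
  have "n * u - x = int a * ((n * u - l) div int a)"
    unfolding x_def by (simp add: algebra_simps flip: minus_mod_eq_mult_div)
  then obtain q where q: "n * u = x + int a * q" by (metis add.commute diff_eq_eq)
  have "n = n * (u * int b + v * int a)" by (simp add: uv)
  also have "\<dots> = n * u * int b + n * v * int a" by (simp add: algebra_simps)
  also have "\<dots> = int b * x + int a * (int b * q + n * v)"
    unfolding q by (simp add: algebra_simps)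
  finally show ?thesis
    using that[of x "int b * q + n * v"] assms(2) by (simp add: x_def)
qed

lemma in_glueI:
  assumes "int n = int b * x + int a * y" "0 \<le> x" "0 \<le> y" "nat x \<in> G" "nat y \<in> H"
  shows "n \<in> glue a b G H"
proof -
  have "int n = int (b * nat x + a * nat y)" using assms by simp
  then have "n = b * nat x + a * nat y" by (simp only: of_nat_eq_iff)
  then show ?thesis unfolding glue_def using assms(4,5) by blast
qed

text \<open>Placing \<open>x\<close> in the window of length \<open>a\<close> that starts at the
  conductor of \<open>G\<close> puts it in \<open>G\<close>; the bound is exactly what then forces
  \<open>y\<close> up to the conductor of \<open>H\<close>.\<close>

lemma glue_large:
  assumes cop: "coprime a b" "a > 0" and num: "numeric_semigroup G" "numeric_semigroup H"
    and n: "int n \<ge> 1 + int a * int b + int b * (int (conductor G) - 1) + int a * (int (conductor H) - 1)"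
  shows "n \<in> glue a b G H"
proof -
  let ?g = "int (conductor G)" and ?h = "int (conductor H)"
  obtain x y where xy: "int n = int b * x + int a * y" "?g \<le> x" "x < ?g + int a"
    using coprime_representation[OF cop] by metis
  have "int b * x \<le> int b * (?g + int a - 1)" using xy(3) by (intro mult_left_mono) auto
  then have "int a * y \<ge> int a * (?h - 1) + 1" using n xy(1) by (simp add: algebra_simps)
  then have "int a * y > int a * (?h - 1)" by simp
  then have "y \<ge> ?h" using cop(2) by (simp add: mult_less_cancel_left)
  then show ?thesis
    using xy num by (intro in_glueI[of n b x a y]) (auto intro!: ge_conductor)
qed

lemma numeric_semigroup_glue:
  assumes cop: "coprime a b" "a > 0" and num: "numeric_semigroup G" "numeric_semigroup H"
  shows "numeric_semigroup (glue a b G H)"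
proof -
  let ?k = "1 + int a * int b + int b * (int (conductor G) - 1) + int a * (int (conductor H) - 1)"
  have "- glue a b G H \<subseteq> {..< nat ?k}"
  proof
    fix n assume "n \<in> - glue a b G H"
    then have "\<not> int n \<ge> ?k" using glue_large[OF assms] by blast
    then show "n \<in> {..< nat ?k}" by auto
  qed
  then have "finite (- glue a b G H)" using finite_subset by blast
  then show ?thesis
    using num by (auto simp: numeric_semigroup_def intro: add_submonoid_glue)
qed

text \<open>\<open>glue_large\<close> is one half. For the other, suppose the candidate for the
  largest gap is bg + ah. The deviations u, v of g, h from c(G) - 1 and c(H) - 1 satisfy bu + av =
  ab, so u = am and v = b(1 - m) by coprimality. One of m, 1 - m is at most 0; adding copies of
  \<open>a\<close> to g, or of \<open>b\<close> to h, then reaches c - 1 inside the semigroup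
  concerned.\<close>

lemma conductor_glue:
  assumes cop: "coprime a b" "a > 0" "b > 0" and num: "numeric_semigroup G" "numeric_semigroup H"
    and mem: "a \<in> G" "b \<in> H"
  shows "int (conductor (glue a b G H)) =
    1 + int a * int b + int b * (int (conductor G) - 1) + int a * (int (conductor H) - 1)" (is "_ = ?C")
proof (rule conductor_eqI)
  show "numeric_semigroup (glue a b G H)" using assms by (simp add: numeric_semigroup_glue)
  \<comment> \<open>The candidate is nonnegative because it equals (a - 1)(b - 1) + b c(G) + a c(H),
    where c denotes the conductor.\<close>
  have "int b * (int (conductor G) - 1) \<ge> int b * (-1)" "int a * (int (conductor H) - 1) \<ge> int a * (-1)"
    by (intro mult_left_mono; simp)+
  moreover have "(int a - 1) * (int b - 1) \<ge> 0" using cop by simp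
  moreover have "?C = (int a - 1) * (int b - 1) + (int b * (int (conductor G) - 1) - int b * (- 1))
      + (int a * (int (conductor H) - 1) - int a * (- 1))"
    by (simp add: algebra_simps)
  ultimately have "?C \<ge> 0" by linarith
  then show "int (nat ?C) = ?C" by simp
  show "n \<in> glue a b G H" if "int n \<ge> ?C" for n using glue_large[OF cop(1,2) num that] .
  show "n \<notin> glue a b G H" if n: "int n = ?C - 1" for n
  proof
    have no_shift: False
      if S: "numeric_semigroup S" "s \<in> S" "int k = int (conductor S) - 1 + int c * m" "m \<le> 0" "k \<in> S" "c \<in> S"
      for S s k c and m :: int
    proof -
      have "int (k + nat (- m) * c) = int (conductor S) - 1" using S by (simp add: algebra_simps)
      moreover have "k + nat (- m) * c \<in> S"
        using S add_submonoid_mult[of S c "nat (-m)"] by (auto simp: numeric_semigroup_def add_submonoid_def)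
      ultimately show False using pred_conductor_notin[OF S(1)] by blast
    qed
    assume "n \<in> glue a b G H"
    then obtain g h where gh: "n = b * g + a * h" "g \<in> G" "h \<in> H" by (auto simp: glue_def)
    define u where "u = int g - (int (conductor G) - 1)"
    define v where "v = int h - (int (conductor H) - 1)"
    have eq: "int b * u + int a * v = int a * int b"
      using n unfolding gh(1) u_def v_def by (simp add: algebra_simps)
    then have "int b * u = int a * (int b - v)" by (simp add: algebra_simps)
    then have "int a dvd int b * u" by simp
    then have "int a dvd u" using cop(1) by (simp add: coprime_dvd_mult_right_iff)
    then obtain m where m: "u = int a * m" by blast
    have "int a * v = int a * (int b * (1 - m))" using eq m by (simp add: algebra_simps)
    then have v: "v = int b * (1 - m)" using cop(2) by simp
    have "int g = int (conductor G) - 1 + int a * m" "int h = int (conductor H) - 1 + int b * (1 - m)"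
      using m v by (simp_all add: u_def v_def)
    then show False
      using no_shift[of G a g a m] no_shift[of H b h b "1 - m"] num mem gh by linarith
  qed
qed

text \<open>Sylvester's count: \<open>n \<mapsto> ab - a - b - n\<close> sends gaps to non-gaps.\<close>

lemma sylvester_gaps:
  assumes "coprime a b" "a > 0" "b > 0"
  shows "finite (- glue a b UNIV UNIV)" "2 * card (- glue a b UNIV UNIV) \<le> (a - 1) * (b - 1)"
proof -
  let ?S = "glue a b UNIV UNIV"
  \<comment> \<open>An integer, because ab - a - b is -1 when a or b is 1; there are no gaps
    then.\<close>
  define F where "F = int a * int b - int a - int b"
  have refl: "n \<le> nat F \<and> int n \<le> F \<and> nat F - n \<in> ?S" if "n \<notin> ?S" for n
  proof -
    obtain x y where xy: "int n = int b * x + int a * y" "0 \<le> x" "x < int a"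
      using coprime_representation[OF assms(1,2), of "int n" 0] by auto
    have "y < 0" using that xy in_glueI[of n b x a y] by force
    \<comment> \<open>Since x < a and y < 0, both coefficients a - 1 - x and -1 - y of the reflected
      number are nonnegative.\<close>
    have eq: "F - int n = int b * (int a - 1 - x) + int a * (- 1 - y)"
      unfolding F_def xy by (simp add: algebra_simps)
    also have "\<dots> \<ge> 0" using xy \<open>y < 0\<close> by auto
    finally have le: "int n \<le> F" by simp
    then have "int (nat F - n) = int b * (int a - 1 - x) + int a * (- 1 - y)" using eq by auto
    then have "nat F - n \<in> ?S" using xy \<open>y < 0\<close> in_glueI[of "nat F - n" b "int a - 1 - x" a "- 1 - y"] by auto
    with le show ?thesis by auto
  qed
  have sub: "- ?S \<subseteq> {n. int n \<le> F}" using refl by auto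
  have fin: "finite {n. int n \<le> F}"
    by (rule finite_subset[of _ "{..nat F}"]) auto
  show fin2: "finite (- ?S)" using sub fin by (rule finite_subset)
  have "card (- ?S) \<le> card ({n. int n \<le> F} \<inter> ?S)"
  proof (rule card_inj_on_le[where f = "\<lambda>n. nat F - n"])
    show "inj_on (\<lambda>n. nat F - n) (- ?S)" using refl by (intro inj_onI) (metis ComplD diff_diff_cancel)
    show "(\<lambda>n. nat F - n) ` (- ?S) \<subseteq> {n. int n \<le> F} \<inter> ?S" using refl by force
  qed (use fin in auto)
  moreover have "card {n. int n \<le> F} = card ({n. int n \<le> F} \<inter> ?S) + card (- ?S)"
  proof -
    have "{n. int n \<le> F} = ({n. int n \<le> F} \<inter> ?S) \<union> - ?S" using sub by auto
    then show ?thesis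
      using card_Un_disjoint[of "{n. int n \<le> F} \<inter> ?S" "- ?S"] fin fin2 by auto
  qed
  moreover have "card {n. int n \<le> F} \<le> nat (F + 1)"
    by (rule order_trans[OF card_mono[of "{..<nat (F+1)}"]]) auto
  moreover have "nat (F + 1) = (a - 1) * (b - 1)"
  proof -
    have "F + 1 = (int a - 1) * (int b - 1)" by (simp add: F_def algebra_simps)
    also have "\<dots> = int ((a - 1) * (b - 1))" using assms by (simp add: of_nat_diff)
    finally show ?thesis by (simp only: nat_int)
  qed
  ultimately show "2 * card (- ?S) \<le> (a - 1) * (b - 1)" by simp
qed

text \<open>A gap of \<open>bG + aH\<close> is a gap of \<open>b\<nat> + a\<nat>\<close>, or has the form \<open>bx + ay\<close> with \<open>x \<notin> G\<close> and
  \<open>y < b\<close>, or has the form \<open>bw + ay\<close> with \<open>w \<in> G\<close> least in its class modulo \<open>a\<close> and \<open>y \<notin> H\<close>.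
  If \<open>a \<notin> G\<close>, then the pair \<open>(x, y) = (a, 0)\<close> is superfluous.\<close>

lemma gaps_glue:
  assumes cop: "coprime a b" "a > 0" "b > 0" and num: "numeric_semigroup G" "numeric_semigroup H"
  shows "2 * num_gaps (glue a b G H) \<le> (a - 1) * (b - 1) + 2 * b * num_gaps G + 2 * a * num_gaps H"
    and "a \<notin> G \<Longrightarrow> 2 * num_gaps (glue a b G H) < (a - 1) * (b - 1) + 2 * b * num_gaps G + 2 * a * num_gaps H"
proof -
  let ?S = "glue a b UNIV UNIV" and ?K = "glue a b G H"
  have finG: "finite (- G)" and finH: "finite (- H)" and G0: "0 \<in> G" and H0: "0 \<in> H"
    using num by (auto simp: numeric_semigroup_def add_submonoid_def)
  define w where "w r = (LEAST g. g \<in> G \<and> g mod a = r)" for r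
  define P where "P = (if a \<in> G then (- G) \<times> {..<b} else (- G) \<times> {..<b} - {(a, 0)})"
  let ?f = "\<lambda>(x, y). b * x + a * y" and ?g = "\<lambda>(r, y). b * w r + a * y"
  have "- ?K \<subseteq> - ?S \<union> ?f ` P \<union> ?g ` ({..<a} \<times> (- H))"
  proof
    fix n assume n: "n \<in> - ?K"
    show "n \<in> - ?S \<union> ?f ` P \<union> ?g ` ({..<a} \<times> (- H))"
    proof (cases "n \<in> ?S \<and> n \<noteq> b * a")
      case True
      then have ab: "n \<noteq> b * a" by simp
      from True
      obtain x0 y0 where n0: "n = b * x0 + a * y0" by (auto simp: glue_def)
      \<comment> \<open>Trading b units of y for a units of x makes y < b without changing the
        value.\<close>
      define x y where "x = x0 + a * (y0 div b)" and "y = y0 mod b"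
      have nxy: "n = b * x + a * y"
      proof -
        have "y0 = b * (y0 div b) + y0 mod b" by simp
        then have "n = b * x0 + a * (b * (y0 div b) + y0 mod b)" using n0 by metis
        also have "\<dots> = b * x + a * y" unfolding x_def y_def by (simp only: algebra_simps)
        finally show ?thesis .
      qed
      have y: "y < b" using cop(3) by (simp add: y_def)
      show ?thesis
      proof (cases "x \<in> G")
        case False
        have "(x, y) \<in> P" using False y ab nxy by (auto simp: P_def)
        then show ?thesis using nxy by force
      next
        case True
        let ?Q = "\<lambda>g. g \<in> G \<and> g mod a = x mod a"
        have w: "?Q (w (x mod a))" unfolding w_def by (rule LeastI[of ?Q x]) (use True in simp)
        have "w (x mod a) \<le> x" unfolding w_def by (rule Least_le) (use True in simp)
        then obtain q where q: "x = w (x mod a) + a * q"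
          using w by (metis mod_eq_nat1E)
        have eq: "n = b * w (x mod a) + a * (y + b * q)"
          by (subst nxy, subst q) (simp add: algebra_simps)
        have "y + b * q \<notin> H"
          using n eq w by (auto simp: glue_def)
        then have "(x mod a, y + b * q) \<in> {..<a} \<times> (- H)" using cop(2) by auto
        then show ?thesis using eq by force
      qed
    next
      case False
      show ?thesis
      proof (cases "n = b * a")
        case True
        have "b * 0 + a * b = n" using True by simp
        then have "b \<notin> H" using n G0 by (auto simp: glue_def)
        moreover have "w 0 = 0" unfolding w_def by (rule Least_equality) (use G0 in auto)
        then have "?g (0, b) = n" using True by simp
        ultimately show ?thesis using cop(2) by blast
      qed (use False in auto)
    qed
  qed
  then have "card (- ?K) \<le> card (- ?S \<union> ?f ` P \<union> ?g ` ({..<a} \<times> (- H)))"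
    using sylvester_gaps(1)[OF cop] finG finH by (intro card_mono) (auto simp: P_def)
  also have "\<dots> \<le> card (- ?S) + card (?f ` P) + card (?g ` ({..<a} \<times> (- H)))"
    by (meson card_Un_le add_right_mono order_trans)
  also have "card (?g ` ({..<a} \<times> (- H))) \<le> a * num_gaps H"
    using card_image_le[of "{..<a} \<times> (- H)" ?g] finH by (simp add: card_cartesian_product num_gaps_def)
  also have "card (?f ` P) \<le> card P"
    using finG by (intro card_image_le) (auto simp: P_def)
  finally have le: "num_gaps ?K \<le> card (- ?S) + card P + a * num_gaps H"
    by (simp add: num_gaps_def)
  have P: "card P \<le> b * num_gaps G" "a \<notin> G \<Longrightarrow> card P < b * num_gaps G"
  proof -
    have full: "card ((- G) \<times> {..<b}) = b * num_gaps G" by (simp add: card_cartesian_product num_gaps_def)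
    show "a \<notin> G \<Longrightarrow> card P < b * num_gaps G"
      unfolding full[symmetric] by (rule psubset_card_mono) (use finG cop(3) in \<open>auto simp: P_def\<close>)
    then show "card P \<le> b * num_gaps G" by (cases "a \<in> G") (auto simp: P_def full)
  qed
  show "2 * num_gaps ?K \<le> (a - 1) * (b - 1) + 2 * b * num_gaps G + 2 * a * num_gaps H"
    using le P(1) sylvester_gaps(2)[OF cop] by linarith
  show "2 * num_gaps ?K < (a - 1) * (b - 1) + 2 * b * num_gaps G + 2 * a * num_gaps H" if "a \<notin> G"
    using le P(2)[OF that] sylvester_gaps(2)[OF cop] by linarith
qed


section \<open>Gluing a finite family with pairwise coprime weights\<close>

definition glue_family :: "'i set \<Rightarrow> ('i \<Rightarrow> nat) \<Rightarrow> ('i \<Rightarrow> nat set) \<Rightarrow> nat set" where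
  "glue_family I a G = {\<Sum>i\<in>I. (\<Prod>j\<in>I - {i}. a j) * g i | g. \<forall>i\<in>I. g i \<in> G i}"

text \<open>For a tree in which the neighbour of the root has the children \<open>I\<close>, the
  middle term is the contribution of that neighbour, whose valency is \<open>card I + 1\<close>, and
  \<open>m i - 1\<close> stands for the sum over the i-th branch. For empty \<open>I\<close> the
  value is 0, the conductor of \<nat>.\<close>

definition family_mu :: "'i set \<Rightarrow> ('i \<Rightarrow> nat) \<Rightarrow> ('i \<Rightarrow> int) \<Rightarrow> int" where
  "family_mu I a m = 1 + (int (card I) - 1) * int (\<Prod>i\<in>I. a i) + (\<Sum>i\<in>I. int (\<Prod>j\<in>I - {i}. a j) * (m i - 1))"

lemma glue_family_singleton [simp]: "glue_family {i} a G = G i"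
  unfolding glue_family_def by (auto intro!: exI[of _ "\<lambda>_. _"])

lemma family_mu_singleton [simp]: "family_mu {i} a m = m i"
  by (simp add: family_mu_def)

text \<open>Stated over a semiring because it serves natural numbers, for semigroups, and integers,
  for \<mu>.\<close>

lemma sum_prod_delete_insert:
  fixes a f :: "'i \<Rightarrow> 'b::comm_semiring_1"
  assumes "finite I" "i \<notin> I"
  shows "(\<Sum>k\<in>insert i I. (\<Prod>j\<in>insert i I - {k}. a j) * f k) =
    (\<Prod>j\<in>I. a j) * f i + a i * (\<Sum>k\<in>I. (\<Prod>j\<in>I - {k}. a j) * f k)"
proof -
  have "(\<Prod>j\<in>insert i I - {k}. a j) = a i * (\<Prod>j\<in>I - {k}. a j)" if "k \<in> I" for k
  proof -
    have "insert i I - {k} = insert i (I - {k})" using that assms by auto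
    then show ?thesis using assms by simp
  qed
  moreover have "insert i I - {i} = I" using assms by auto
  ultimately show ?thesis using assms by (simp add: sum_distrib_left mult.assoc)
qed

text \<open>Adding \<open>i\<close> multiplies every old cofactor by \<open>a i\<close>, while the
  cofactor of \<open>i\<close> is the product of all old weights. Hence the two gluing
  weights.\<close>

lemma glue_family_insert:
  assumes "finite I" "i \<notin> I"
  shows "glue_family (insert i I) a G = glue (a i) (\<Prod>j\<in>I. a j) (G i) (glue_family I a G)"
proof (intro equalityI subsetI)
  fix n assume "n \<in> glue_family (insert i I) a G"
  then obtain g where "\<forall>k\<in>insert i I. g k \<in> G k"
    "n = (\<Prod>j\<in>I. a j) * g i + a i * (\<Sum>k\<in>I. (\<Prod>j\<in>I - {k}. a j) * g k)"
    using sum_prod_delete_insert[OF assms, of a] by (auto simp: glue_family_def)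
  then show "n \<in> glue (a i) (\<Prod>j\<in>I. a j) (G i) (glue_family I a G)"
    by (auto simp: glue_def glue_family_def)
next
  fix n assume "n \<in> glue (a i) (\<Prod>j\<in>I. a j) (G i) (glue_family I a G)"
  then obtain g h where gh: "g \<in> G i" "\<forall>k\<in>I. h k \<in> G k"
    "n = (\<Prod>j\<in>I. a j) * g + a i * (\<Sum>k\<in>I. (\<Prod>j\<in>I - {k}. a j) * h k)"
    by (auto simp: glue_def glue_family_def)
  have "(\<Sum>k\<in>I. (\<Prod>j\<in>I - {k}. a j) * h k) = (\<Sum>k\<in>I. (\<Prod>j\<in>I - {k}. a j) * (h(i := g)) k)"
    using assms by (intro sum.cong) auto
  then have "n = (\<Sum>k\<in>insert i I. (\<Prod>j\<in>insert i I - {k}. a j) * (h(i := g)) k)"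
    unfolding sum_prod_delete_insert[OF assms] using gh(3) by simp
  moreover have "\<forall>k\<in>insert i I. (h(i := g)) k \<in> G k" using gh by auto
  ultimately show "n \<in> glue_family (insert i I) a G" unfolding glue_family_def by blast
qed

lemma family_mu_insert:
  assumes "finite I" "i \<notin> I"
  shows "family_mu (insert i I) a m = 1 + int (a i) * int (\<Prod>j\<in>I. a j)
    + int (\<Prod>j\<in>I. a j) * (m i - 1) + int (a i) * (family_mu I a m - 1)"
  using assms sum_prod_delete_insert[OF assms, of "\<lambda>j. int (a j)" "\<lambda>j. m j - 1"]
  by (simp add: family_mu_def algebra_simps)

text \<open>A single summand, \<open>a k\<close> times its cofactor, is already the whole product.
  This supplies the membership b \<in> H when the next semigroup is glued on.\<close>

lemma prod_in_glue_family:
  assumes "finite I" "I \<noteq> {}" "\<And>i. i \<in> I \<Longrightarrow> a i \<in> G i" "\<And>i. i \<in> I \<Longrightarrow> 0 \<in> G i"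
  shows "(\<Prod>i\<in>I. a i) \<in> glue_family I a G"
proof -
  obtain k where k: "k \<in> I" using assms(2) by blast
  have "(\<Sum>i\<in>I. (\<Prod>j\<in>I - {i}. a j) * (if i = k then a k else 0)) = (\<Prod>j\<in>I - {k}. a j) * a k"
    using assms(1) k by (simp add: sum.delta' if_distrib cong: if_cong)
  also have "\<dots> = (\<Prod>i\<in>I. a i)" using assms(1) k by (simp add: prod.remove mult.commute)
  finally show ?thesis using assms(3,4) k unfolding glue_family_def
    by (intro CollectI exI[of _ "\<lambda>i. if i = k then a k else 0"]) auto
qed

text \<open>\<open>gaps_glue\<close> in the integer shape of \<open>family_mu_insert\<close>, by (a
  - 1)(b - 1) = 1 + ab - a - b. Strictness for a \<notin> G carries over to b \<notin> H because
  gluing is symmetric.\<close>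

lemma gaps_glue_mu:
  assumes "coprime a b" "a > 0" "b > 0" "numeric_semigroup G" "numeric_semigroup H"
  shows "int (2 * num_gaps (glue a b G H)) \<le>
      1 + int a * int b + int b * (int (2 * num_gaps G) - 1) + int a * (int (2 * num_gaps H) - 1)"
    and "int (2 * num_gaps (glue a b G H)) =
      1 + int a * int b + int b * (int (2 * num_gaps G) - 1) + int a * (int (2 * num_gaps H) - 1) \<Longrightarrow>
      a \<in> G \<and> b \<in> H"
proof -
  let ?l = "int (2 * num_gaps (glue a b G H))"
  let ?r = "1 + int a * int b + int b * (int (2 * num_gaps G) - 1) + int a * (int (2 * num_gaps H) - 1)"
  have r: "?r = int ((a - 1) * (b - 1) + 2 * b * num_gaps G + 2 * a * num_gaps H)"
  proof -
    obtain a' b' where "a = Suc a'" "b = Suc b'" using assms(2,3) by (metis gr0_implies_Suc)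
    then show ?thesis by (simp add: algebra_simps)
  qed
  show "?l \<le> ?r" using gaps_glue(1)[OF assms] unfolding r by linarith
  show "a \<in> G \<and> b \<in> H" if "?l = ?r"
  proof -
    have eq: "2 * num_gaps (glue a b G H) = (a - 1) * (b - 1) + 2 * b * num_gaps G + 2 * a * num_gaps H"
      using that unfolding r by linarith
    then have "2 * num_gaps (glue b a H G) = (b - 1) * (a - 1) + 2 * a * num_gaps H + 2 * b * num_gaps G"
      by (simp add: glue_commute[of b a] mult.commute)
    then show ?thesis
      using eq gaps_glue(2)[OF assms] gaps_glue(2)[of b a H G] assms by (auto simp: coprime_commute)
  qed
qed

locale coprime_family =
  fixes I :: "'i set" and a :: "'i \<Rightarrow> nat" and G :: "'i \<Rightarrow> nat set"
  assumes finite_I: "finite I" and nonempty: "I \<noteq> {}"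
    and a_pos: "\<And>i. i \<in> I \<Longrightarrow> a i > 0"
    and cop: "\<And>i j. i \<in> I \<Longrightarrow> j \<in> I \<Longrightarrow> i \<noteq> j \<Longrightarrow> coprime (a i) (a j)"
    and num: "\<And>i. i \<in> I \<Longrightarrow> numeric_semigroup (G i)"
begin

text \<open>Induction starts at singletons since the empty family yields {0}, which is not cofinite.
  Pairwise coprimality becomes coprimality to the product of the weights already glued.\<close>

lemma subfamily_induct [consumes 2, case_names singleton insert]:
  assumes "J \<subseteq> I" "J \<noteq> {}"
    and single: "\<And>i. i \<in> I \<Longrightarrow> P {i}"
    and insert: "\<And>i J. i \<in> I \<Longrightarrow> J \<subseteq> I \<Longrightarrow> J \<noteq> {} \<Longrightarrow> finite J \<Longrightarrow> i \<notin> J \<Longrightarrow>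
      coprime (a i) (\<Prod>j\<in>J. a j) \<Longrightarrow> a i > 0 \<Longrightarrow> (\<Prod>j\<in>J. a j) > 0 \<Longrightarrow> numeric_semigroup (G i) \<Longrightarrow>
      P J \<Longrightarrow> P (insert i J)"
  shows "P J"
proof -
  have "finite J" using assms(1) finite_I finite_subset by blast
  then show ?thesis using assms(2,1)
  proof (induction J rule: finite_ne_induct)
    case (insert i J)
    then have "coprime (a i) (\<Prod>j\<in>J. a j)" by (intro prod_coprime_right cop) auto
    moreover have "(\<Prod>j\<in>J. a j) > 0" by (rule prod_pos) (use insert a_pos in blast)
    ultimately show ?case using insert num a_pos by (intro assms(4)) auto
  qed (use single in auto)
qed

lemma numeric_semigroup_subfamily:
  "J \<subseteq> I \<Longrightarrow> J \<noteq> {} \<Longrightarrow> numeric_semigroup (glue_family J a G)"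
proof (induction J rule: subfamily_induct)
  case (singleton i)
  then show ?case using num by simp
next
  case (insert i J)
  then show ?case by (simp add: glue_family_insert numeric_semigroup_glue)
qed

text \<open>\<open>P\<close> is arbitrary here; it will be the existence of a complete intersection
  presentation.\<close>

lemma glue_family_closed:
  assumes "\<And>i. i \<in> I \<Longrightarrow> a i \<in> G i" "\<And>i. i \<in> I \<Longrightarrow> P (G i)"
    and "\<And>a b G H. coprime a b \<Longrightarrow> a > 0 \<Longrightarrow> b > 0 \<Longrightarrow> a \<in> G \<Longrightarrow> b \<in> H \<Longrightarrow> P G \<Longrightarrow> P H \<Longrightarrow> P (glue a b G H)"
  shows "P (glue_family I a G)"
proof -
  have "P (glue_family J a G)" if "J \<subseteq> I" "J \<noteq> {}" for J
    using that
  proof (induction J rule: subfamily_induct)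
    case (insert i J)
    have "(\<Prod>j\<in>J. a j) \<in> glue_family J a G"
      using insert num assms(1)
      by (intro prod_in_glue_family) (auto simp: numeric_semigroup_def add_submonoid_def)
    then show ?case using insert assms by (simp add: glue_family_insert)
  qed (simp add: assms)
  then show ?thesis using nonempty by blast
qed

lemma conductor_glue_family:
  assumes "\<And>i. i \<in> I \<Longrightarrow> a i \<in> G i"
  shows "int (conductor (glue_family I a G)) = family_mu I a (\<lambda>i. int (conductor (G i)))"
proof -
  have "int (conductor (glue_family J a G)) = family_mu J a (\<lambda>i. int (conductor (G i)))"
    if "J \<subseteq> I" "J \<noteq> {}" for J
    using that
  proof (induction J rule: subfamily_induct)
    case (insert i J)
    have "(\<Prod>j\<in>J. a j) \<in> glue_family J a G"
      using insert num assms(1)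
      by (intro prod_in_glue_family) (auto simp: numeric_semigroup_def add_submonoid_def)
    then show ?case using insert assms numeric_semigroup_subfamily[of J]
      by (simp add: glue_family_insert family_mu_insert conductor_glue)
  qed simp
  then show ?thesis using nonempty by blast
qed

text \<open>The bound for \<open>insert i J\<close> passes through the bound for \<open>J\<close>
  multiplied by \<open>a i\<close> > 0, so equality at the end forces equality at every stage. Two
  members are required because for one member equality holds whatever its weight.\<close>

lemma gaps_glue_family:
  shows "int (2 * num_gaps (glue_family I a G)) \<le> family_mu I a (\<lambda>i. int (2 * num_gaps (G i)))"
    and "int (2 * num_gaps (glue_family I a G)) = family_mu I a (\<lambda>i. int (2 * num_gaps (G i))) \<Longrightarrow>
      card I \<ge> 2 \<Longrightarrow> i \<in> I \<Longrightarrow> a i \<in> G i"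
proof -
  let ?d = "\<lambda>J. int (2 * num_gaps (glue_family J a G))"
  let ?m = "\<lambda>J. family_mu J a (\<lambda>i. int (2 * num_gaps (G i)))"
  have "?d J \<le> ?m J \<and> (?d J = ?m J \<longrightarrow> card J \<ge> 2 \<longrightarrow> (\<forall>i\<in>J. a i \<in> G i))"
    if "J \<subseteq> I" "J \<noteq> {}" for J
    using that
  proof (induction J rule: subfamily_induct)
    case (insert i J)
    let ?b = "\<Prod>j\<in>J. a j"
    have num_J: "numeric_semigroup (glue_family J a G)"
      using insert by (intro numeric_semigroup_subfamily)
    note glue = gaps_glue_mu[OF insert(6-9) num_J, folded glue_family_insert[OF insert(4,5)]]
    have m: "?m (insert i J) = 1 + int (a i) * int ?b + int ?b * (int (2 * num_gaps (G i)) - 1)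
        + int (a i) * (?m J - 1)"
      by (rule family_mu_insert[OF insert(4,5)])
    have IH: "?d J \<le> ?m J" "?d J = ?m J \<Longrightarrow> card J \<ge> 2 \<Longrightarrow> \<forall>i\<in>J. a i \<in> G i"
      using insert by auto
    have mono: "int (a i) * (?d J - 1) \<le> int (a i) * (?m J - 1)"
      using IH(1) by (intro mult_left_mono) auto
    have le: "?d (insert i J) \<le> ?m (insert i J)" using glue(1) mono m by linarith
    have "\<forall>k\<in>insert i J. a k \<in> G k" if eq: "?d (insert i J) = ?m (insert i J)"
    proof -
      have "int (a i) * (?d J - 1) = int (a i) * (?m J - 1)" using glue(1) mono m eq by linarith
      then have "?d J = ?m J" using insert(7) by simp
      then have mem: "a i \<in> G i" "?b \<in> glue_family J a G" using glue(2) eq m by simp_all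
      have "\<forall>k\<in>J. a k \<in> G k"
      proof (cases "card J \<ge> 2")
        case True
        then show ?thesis using IH \<open>?d J = ?m J\<close> by blast
      next
        \<comment> \<open>For a singleton {k} the induction hypothesis is silent, but the product is
          then \<open>a k\<close> and the family glues to \<open>G k\<close>, so
          \<open>mem(2)\<close> is the claim.\<close>
        case False
        moreover have "card J \<noteq> 0" using insert by simp
        ultimately have "card J = 1" by simp
        then obtain k where "J = {k}" by (auto simp: card_1_singleton_iff)
        then show ?thesis using mem(2) by simp
      qed
      then show ?thesis using mem by blast
    qed
    then show ?case using le by blast
  qed simp
  then show "?d I \<le> ?m I" "?d I = ?m I \<Longrightarrow> card I \<ge> 2 \<Longrightarrow> i \<in> I \<Longrightarrow> a i \<in> G i"
    using nonempty by blast+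
qed

text \<open>All cofactors are positive, so the terms compare one by one and equal sums force equal
  terms.\<close>

lemma family_mu_mono:
  assumes "\<And>i. i \<in> I \<Longrightarrow> m i \<le> m' i"
  shows "family_mu I a m \<le> family_mu I a m'"
    and "family_mu I a m = family_mu I a m' \<Longrightarrow> i \<in> I \<Longrightarrow> m i = m' i"
proof -
  let ?f = "\<lambda>i. int (\<Prod>j\<in>I - {i}. a j)"
  have pos: "?f i > 0" for i
    unfolding of_nat_0_less_iff by (rule prod_pos) (use a_pos in auto)
  have le: "?f i * (m i - 1) \<le> ?f i * (m' i - 1)" if "i \<in> I" for i
    using assms[OF that] pos[of i] by (intro mult_left_mono) auto
  show "family_mu I a m \<le> family_mu I a m'"
    unfolding family_mu_def using sum_mono[of I "\<lambda>i. ?f i * (m i - 1)"] le by simp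
  assume "family_mu I a m = family_mu I a m'" and i: "i \<in> I"
  then have "(\<Sum>i\<in>I. ?f i * (m i - 1)) = (\<Sum>i\<in>I. ?f i * (m' i - 1))"
    by (simp add: family_mu_def)
  then have "?f i * (m i - 1) = ?f i * (m' i - 1)"
    using sum_strict_mono_ex1[OF finite_I, of "\<lambda>i. ?f i * (m i - 1)" "\<lambda>i. ?f i * (m' i - 1)"] le i
    by force
  then show "m i = m' i" using pos[of i] by simp
qed

end

section \<open>Paths in trees\<close>

lemma is_path_iff:
  "is_path \<Delta> u p v \<longleftrightarrow> p \<noteq> [] \<and> hd p = u \<and> last p = v \<and> set p \<subseteq> vertices \<Delta> \<and> distinct p \<and>
     successively (\<lambda>x y. {x, y} \<in> edges \<Delta>) p"
  unfolding is_path_def successively_conv_nth by auto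

lemma is_path_prefix:
  assumes "is_path \<Delta> u (p @ y # q) v"
  shows "is_path \<Delta> u (p @ [y]) y"
  using assms unfolding is_path_iff
  by (cases p) (auto simp: successively_append_iff successively_Cons hd_append)

lemma is_path_snoc:
  assumes "is_path \<Delta> u p x" "{x, y} \<in> edges \<Delta>" "y \<in> vertices \<Delta>" "y \<notin> set p"
  shows "is_path \<Delta> u (p @ [y]) y"
  using assms unfolding is_path_iff by (auto simp: successively_append_iff)

lemma is_path_Cons:
  "is_path \<Delta> u (x # y # p) v \<longleftrightarrow> x = u \<and> x \<in> vertices \<Delta> \<and> x \<notin> set (y # p) \<and> {x, y} \<in> edges \<Delta> \<and> is_path \<Delta> y (y # p) v"
  unfolding is_path_iff by auto

text \<open>Two paths that leave u by different edges meet again. Following one to the meeting point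
  and the other back gives a path from u to its second neighbour c, which the edge {c, u} closes to
  a cycle.\<close>

lemma is_path_unique:
  assumes "finite_tree \<Delta>" "is_path \<Delta> u p v" "is_path \<Delta> u q v"
  shows "p = q"
  using assms(2,3)
proof (induction p arbitrary: u q)
  case Nil
  then show ?case by (simp add: is_path_iff)
next
  case (Cons a p')
  have a: "a = u" using Cons(2) by (simp add: is_path_iff)
  obtain q' where q: "q = u # q'" using Cons(3) by (cases q) (auto simp: is_path_iff)
  show ?case
  proof (cases "p' = [] \<or> q' = []")
    case True
    then show ?thesis using Cons(2,3) a unfolding q is_path_iff
      by (auto split: if_splits dest: last_in_set)
  next
    case False
    obtain b p'' where p': "p' = b # p''" using False by (cases p') auto
    obtain c q'' where q': "q' = c # q''" using False by (cases q') auto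
    have pth: "is_path \<Delta> b p' v" "is_path \<Delta> c q' v" "{u, b} \<in> edges \<Delta>" "{u, c} \<in> edges \<Delta>"
      "u \<in> vertices \<Delta>" "u \<notin> set p'" "u \<notin> set q'"
      using Cons(2,3) unfolding a q p' q' is_path_Cons by auto
    show ?thesis
    proof (cases "b = c")
      case True
      then show ?thesis using Cons(1)[of b q'] pth a q by simp
    next
      case False
      have "v \<in> set p'" "v \<in> set q'" using pth(1,2) by (metis is_path_iff last_in_set)+
      \<comment> \<open>Taking the first vertex of p' that lies on q' keeps \<open>C\<close> free of
        repetitions.\<close>
      then obtain p1 z p2 where p1: "p' = p1 @ z # p2" "z \<in> set q'" "\<forall>y\<in>set p1. y \<notin> set q'"
        using split_list_first_prop[of p' "\<lambda>z. z \<in> set q'"] by blast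
      then obtain q1 q2 where q1: "q' = q1 @ z # q2" by (meson split_list)
      define C where "C = u # p1 @ z # rev q1"
      have "successively (\<lambda>x y. {x, y} \<in> edges \<Delta>) (u # p')"
        "successively (\<lambda>x y. {x, y} \<in> edges \<Delta>) (q1 @ z # q2)"
        using pth by (auto simp: is_path_iff p' q' q1[symmetric])
      then have "successively (\<lambda>x y. {x, y} \<in> edges \<Delta>) (u # p1 @ [z])"
        "successively (\<lambda>x y. {x, y} \<in> edges \<Delta>) (rev (q1 @ [z]))"
        unfolding p1(1) successively_rev
        by (auto simp: successively_append_iff successively_Cons insert_commute hd_append)
      then have "successively (\<lambda>x y. {x, y} \<in> edges \<Delta>) C"
        unfolding C_def by (auto simp: successively_append_iff successively_Cons hd_append)
      moreover have "distinct C" "set C \<subseteq> vertices \<Delta>"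
        using pth p1 q1 unfolding C_def by (auto simp: is_path_iff)
      moreover have last: "last C = c" using q' q1 unfolding C_def by (cases q1) auto
      ultimately have "is_path \<Delta> u C c" unfolding is_path_iff by (auto simp: C_def)
      moreover have "length C \<ge> 3"
        using False p' p1(1) q' q1 unfolding C_def by (cases p1; cases q1) auto
      moreover have "{c, u} \<in> edges \<Delta>" using pth(4) by (simp add: insert_commute)
      ultimately show ?thesis using assms(1) unfolding finite_tree_def by blast
    qed
  qed
qed

lemma shortest_path_eq:
  assumes "finite_tree \<Delta>" "is_path \<Delta> u p v"
  shows "shortest_path \<Delta> u v = p"
  unfolding shortest_path_def using arg_min_natI[of "\<lambda>p. is_path \<Delta> u p v" p length] assms
  by (blast intro: is_path_unique)

text \<open>A vertex already on the path is reached by cutting the path off there, so walks can be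
  shortened to paths one step at a time.\<close>

lemma is_path_append:
  assumes "is_path \<Delta> u p x" "{x, y} \<in> edges \<Delta>" "y \<in> vertices \<Delta>"
  shows "\<exists>q. is_path \<Delta> u q y"
  using is_path_snoc[OF assms] is_path_prefix assms(1) by (metis split_list)

lemma is_path_trans:
  assumes "is_path \<Delta> u p v" "is_path \<Delta> v q w"
  shows "\<exists>q. is_path \<Delta> u q w"
  using assms
proof (induction q arbitrary: v p)
  case (Cons x q)
  show ?case
  proof (cases q)
    case Nil
    then show ?thesis using Cons by (auto simp: is_path_iff)
  next
    case (Cons y q')
    then have *: "{v, y} \<in> edges \<Delta>" "is_path \<Delta> y q w"
      using Cons.prems(2) by (auto simp: is_path_Cons)
    then have "y \<in> vertices \<Delta>" by (auto simp: is_path_iff)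
    then show ?thesis using is_path_append[OF Cons.prems(1) *(1)] Cons.IH *(2) by blast
  qed
qed (simp add: is_path_iff)

lemma is_path_rev: "is_path \<Delta> u p v \<Longrightarrow> is_path \<Delta> v (rev p) u"
  unfolding is_path_iff by (auto simp: hd_rev last_rev insert_commute)

lemma path_edges_Cons: "path_edges (x # y # p) = insert {x, y} (path_edges (y # p))"
proof (intro equalityI subsetI)
  fix e assume "e \<in> path_edges (x # y # p)"
  then obtain i where "e = {(x # y # p) ! i, (y # p) ! i}" "i < length (y # p)"
    by (auto simp: path_edges_def)
  then show "e \<in> insert {x, y} (path_edges (y # p))"
    by (cases i) (auto simp: path_edges_def)
next
  fix e assume "e \<in> insert {x, y} (path_edges (y # p))"
  then consider "e = {x, y}" | i where "e = {(y # p) ! i, (y # p) ! Suc i}" "Suc i < length (y # p)"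
    by (auto simp: path_edges_def)
  then show "e \<in> path_edges (x # y # p)"
  proof cases
    case 1
    then show ?thesis unfolding path_edges_def by (intro CollectI exI[of _ 0]) auto
  next
    case 2
    then show ?thesis unfolding path_edges_def by (intro CollectI exI[of _ "Suc i"]) auto
  qed
qed

lemma path_edges_subset: "e \<in> path_edges p \<Longrightarrow> e \<subseteq> set p"
  unfolding path_edges_def by auto

lemma path_edges_append: "{x, y} \<in> path_edges (p @ x # y # q)"
  unfolding path_edges_def by (rule CollectI, rule exI[of _ "length p"]) (simp add: nth_append)

section \<open>Cutting a tree at the neighbour of its root\<close>

locale rooted_tree =
  fixes \<Delta> :: "'a wtree"
  assumes weighted_rooted_tree: "weighted_rooted_tree \<Delta>"
begin

abbreviation "V \<equiv> vertices \<Delta>"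
abbreviation "E \<equiv> edges \<Delta>"
abbreviation "r \<equiv> root_vertex \<Delta>"
abbreviation "T \<equiv> shortest_path \<Delta> r"

lemma finite_tree: "finite_tree \<Delta>" and root_in: "r \<in> V" and valency_root: "valency \<Delta> r = 1"
  using weighted_rooted_tree by (auto simp: weighted_rooted_tree_def)

lemma finite_V: "finite V"
  using finite_tree by (simp add: finite_tree_def)

lemma edgeD: "{x, y} \<in> E \<Longrightarrow> x \<in> V \<and> y \<in> V \<and> x \<noteq> y"
  using finite_tree by (force simp: finite_tree_def)

lemma edge_at:
  assumes "e \<in> E" "x \<in> e"
  obtains y where "e = {x, y}" "y \<noteq> x"
proof -
  have "card e = 2" using finite_tree assms(1) by (auto simp: finite_tree_def)
  then show ?thesis using that assms(2) by (auto simp: card_2_iff)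
qed

lemma finite_E: "finite E"
  by (rule finite_subset[of _ "Pow V"]) (use finite_tree finite_V in \<open>auto simp: finite_tree_def\<close>)

lemma T_path: "x \<in> V \<Longrightarrow> is_path \<Delta> r (T x) x"
  using finite_tree root_in shortest_path_eq[OF finite_tree] by (metis finite_tree_def)

lemma T_eq: "is_path \<Delta> r p x \<Longrightarrow> T x = p"
  using shortest_path_eq[OF finite_tree] .

lemma T_last: "x \<in> V \<Longrightarrow> last (T x) = x"
  using T_path by (auto simp: is_path_iff)

lemma T_distinct: "x \<in> V \<Longrightarrow> distinct (T x)"
  using T_path by (auto simp: is_path_iff)

lemma T_subset: "x \<in> V \<Longrightarrow> set (T x) \<subseteq> V"
  using T_path by (auto simp: is_path_iff)

lemma T_root: "T r = [r]"
  by (rule T_eq) (use root_in in \<open>simp add: is_path_iff\<close>)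

lemma T_prefix:
  assumes "x \<in> V" "T x = p @ y # q"
  shows "T y = p @ [y]"
  by (rule T_eq, rule is_path_prefix) (use T_path[OF assms(1)] assms(2) in simp)

lemma T_trans:
  assumes "x \<in> V" "y \<in> set (T x)"
  shows "set (T y) \<subseteq> set (T x)"
  using assms by (metis T_prefix append.assoc append_Cons append_Nil set_append split_list sup_ge1)

text \<open>If y lies on the path to x, the segment from y to x and the edge between them form a
  cycle, unless the segment is that edge.\<close>

lemma T_edge:
  assumes "{x, y} \<in> E"
  shows "T y = T x @ [y] \<or> T x = T y @ [x]"
proof (cases "y \<in> set (T x)")
  case False
  then show ?thesis
    using is_path_snoc[OF T_path assms] edgeD[OF assms] T_eq by blast
next
  case True
  have V: "x \<in> V" "y \<in> V" "x \<noteq> y" using edgeD[OF assms] by auto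
  obtain p q where pq: "T x = p @ y # q" using True by (meson split_list)
  have path: "is_path \<Delta> y (y # q) x"
    using T_path[OF V(1)] unfolding pq is_path_iff by (auto simp: successively_append_iff split: if_splits)
  then have "\<not> length (y # q) \<ge> 3"
    using finite_tree assms unfolding finite_tree_def by blast
  moreover have "q \<noteq> []" using path V(3) by (auto simp: is_path_iff)
  ultimately obtain z where "q = [z]" by (cases q) (auto simp: Suc_le_eq)
  then have "q = [x]" using path by (simp add: is_path_iff)
  then show ?thesis using pq T_prefix[OF V(1) pq] by simp
qed

definition children :: "'a \<Rightarrow> 'a set" where
  "children x = {y. {x, y} \<in> E \<and> T y = T x @ [y]}"

lemma childrenD: "y \<in> children x \<Longrightarrow> x \<in> V \<and> y \<in> V \<and> x \<noteq> y"
  using edgeD by (auto simp: children_def)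

lemma finite_children: "finite (children x)"
  by (rule finite_subset[OF _ finite_V]) (use childrenD in auto)

lemma down_edges_eq:
  assumes "x \<in> V"
  shows "down_edges \<Delta> x = (\<lambda>y. {x, y}) ` children x"
proof (intro equalityI subsetI)
  fix e assume "e \<in> down_edges \<Delta> x"
  then have e: "e \<in> E" "x \<in> e" "e \<notin> path_edges (T x)" by (auto simp: down_edges_def)
  then obtain y where y: "e = {x, y}" using edge_at by metis
  have "T x \<noteq> T y @ [x]"
  proof
    assume eq: "T x = T y @ [x]"
    have "T y \<noteq> []" "last (T y) = y" using T_path[of y] edgeD e y by (auto simp: is_path_iff)
    then have "T x = butlast (T y) @ y # x # []" using eq by (metis append.assoc append_Cons append_Nil append_butlast_last_id)
    then show False using e(3) path_edges_append[of y x "butlast (T y)" "[]"] y by (simp add: insert_commute)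
  qed
  then show "e \<in> (\<lambda>y. {x, y}) ` children x" using T_edge[of x y] e y by (auto simp: children_def)
next
  fix e assume "e \<in> (\<lambda>y. {x, y}) ` children x"
  then obtain y where y: "e = {x, y}" "y \<in> children x" by blast
  then have "y \<notin> set (T x)" using T_distinct[of y] childrenD by (auto simp: children_def)
  then have "e \<notin> path_edges (T x)" using path_edges_subset y(1) by blast
  then show "e \<in> down_edges \<Delta> x" using y by (auto simp: down_edges_def children_def)
qed

lemma inj_on_edge: "inj_on (\<lambda>y. {x, y}) (children x)"
  by (auto simp: inj_on_def doubleton_eq_iff)

text \<open>The path to z cut off at y is the path to y, which enters y from its parent x.\<close>

lemma down_edge_in_path:
  assumes "y \<in> children x" "z \<in> V"
  shows "{x, y} \<in> path_edges (T z) \<longleftrightarrow> y \<in> set (T z)"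
proof
  show "{x, y} \<in> path_edges (T z) \<Longrightarrow> y \<in> set (T z)" using path_edges_subset by blast
  assume "y \<in> set (T z)"
  then obtain p q where pq: "T z = p @ y # q" by (meson split_list)
  then have "p = T x" using T_prefix[OF assms(2) pq] assms(1) by (simp add: children_def)
  moreover have "T x \<noteq> []" "last (T x) = x" using T_path[of x] childrenD assms(1) by (auto simp: is_path_iff)
  ultimately have "T z = butlast (T x) @ x # y # q" using pq by (metis append.assoc append_Cons append_Nil append_butlast_last_id)
  then show "{x, y} \<in> path_edges (T z)" using path_edges_append by metis
qed

text \<open>The only neighbour of the root.\<close>

definition n where "n = (THE y. {r, y} \<in> E)"

lemma root_edges: "{e \<in> E. r \<in> e} = {{r, n}}"
proof -
  obtain e where e: "{e \<in> E. r \<in> e} = {e}"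
    using valency_root unfolding valency_def by (rule card_1_singletonE)
  have "e \<in> {e \<in> E. r \<in> e}" unfolding e by simp
  then obtain y where y: "e = {r, y}" "{r, y} \<in> E" using edge_at[of e r] by (metis (no_types, lifting) mem_Collect_eq)
  have "n = y" unfolding n_def
  proof (rule the_equality)
    show "{r, y} \<in> E" by fact
    fix z assume "{r, z} \<in> E"
    then have "{r, z} \<in> {e \<in> E. r \<in> e}" by simp
    then have "{r, z} = {r, y}" unfolding e y(1) by simp
    then show "z = y" unfolding doubleton_eq_iff by metis
  qed
  then show ?thesis unfolding e y(1) by simp
qed

lemma n_edge: "{r, n} \<in> E"
proof -
  have "{r, n} \<in> {e \<in> E. r \<in> e}" unfolding root_edges by simp
  then show ?thesis by simp
qed

lemma root_edge_unique: "e \<in> E \<Longrightarrow> r \<in> e \<Longrightarrow> e = {r, n}"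
  using root_edges by (metis (mono_tags, lifting) mem_Collect_eq singletonD)

lemma root_edgeD:
  assumes "{r, y} \<in> E"
  shows "y = n"
proof -
  have "{r, y} \<in> {e \<in> E. r \<in> e}" using assms by simp
  then have "{r, y} = {r, n}" unfolding root_edges by simp
  then show ?thesis unfolding doubleton_eq_iff by metis
qed

lemma n_in: "n \<in> V" "n \<noteq> r"
  using edgeD[OF n_edge] by auto

lemma T_n: "T n = [r, n]"
  by (rule T_eq) (use n_edge n_in root_in in \<open>auto simp: is_path_iff\<close>)

lemma T_nonroot:
  assumes "x \<in> V" "x \<noteq> r"
  obtains p where "T x = r # n # p"
proof -
  have pth: "is_path \<Delta> r (T x) x" using T_path assms by simp
  then obtain y p where p: "T x = r # y # p"
    using assms(2) by (cases "T x"; cases "tl (T x)") (auto simp: is_path_iff)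
  then have "{r, y} \<in> E" using pth by (simp add: is_path_Cons)
  then show ?thesis using p root_edgeD that by blast
qed

section \<open>The branches below the neighbour of the root\<close>

abbreviation "I \<equiv> children n"

lemma T_child: "z \<in> I \<Longrightarrow> T z = [r, n, z]"
  by (simp add: children_def T_n)

lemma I_neq: "z \<in> I \<Longrightarrow> z \<noteq> n \<and> z \<noteq> r"
  using T_distinct[of z] T_child[of z] childrenD[of z n] by auto

lemma children_root: "y \<in> children x \<Longrightarrow> y \<noteq> r"
  using T_path[of x] childrenD[of y x] by (auto simp: children_def T_root is_path_iff)

definition D where "D z = {x \<in> V. z \<in> set (T x)}"

lemma T_D:
  assumes "z \<in> I" "x \<in> D z"
  obtains q where "T x = r # n # z # q"
proof -
  have "x \<in> V" "z \<in> set (T x)" using assms by (auto simp: D_def)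
  then obtain p q where pq: "T x = p @ z # q" by (meson split_list)
  have "p = [r, n]" using T_prefix[OF \<open>x \<in> V\<close> pq] T_child[OF assms(1)] by simp
  then show ?thesis using pq that by simp
qed

lemma D_disjoint: "z \<in> I \<Longrightarrow> z' \<in> I \<Longrightarrow> z \<noteq> z' \<Longrightarrow> D z \<inter> D z' = {}"
proof (rule ccontr)
  assume z: "z \<in> I" "z' \<in> I" "z \<noteq> z'" and "D z \<inter> D z' \<noteq> {}"
  then obtain x where "x \<in> D z" "x \<in> D z'" by blast
  then show False using T_D[OF z(1), of x] T_D[OF z(2), of x] z(3) by (metis list.inject)
qed

lemma r_n_notin_D: "z \<in> I \<Longrightarrow> r \<notin> D z" "z \<in> I \<Longrightarrow> n \<notin> D z"
  using I_neq by (auto simp: D_def T_root T_n)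

text \<open>The path to a vertex other than \<open>r\<close> starts with \<open>r\<close>,
  \<open>n\<close>; its third vertex, if there is one, names the branch.\<close>

lemma V_partition: "V - {r} = insert n (\<Union>z\<in>I. D z)"
proof (intro equalityI subsetI)
  fix x assume x: "x \<in> V - {r}"
  show "x \<in> insert n (\<Union>z\<in>I. D z)"
  proof (cases "x = n")
    case False
    obtain p where p: "T x = r # n # p" using T_nonroot x by blast
    have pth: "is_path \<Delta> r (T x) x" using T_path x by simp
    then obtain z q where q: "T x = r # n # z # q" using False p by (cases p) (auto simp: is_path_iff)
    have "T z = [r, n] @ [z]" by (rule T_prefix[of x _ _ q]) (use x q in auto)
    moreover have "{n, z} \<in> E" using pth unfolding q by (simp add: is_path_iff)
    ultimately have "z \<in> I" by (simp add: children_def T_n)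
    moreover have "x \<in> D z" using x q by (simp add: D_def)
    ultimately show ?thesis by blast
  qed simp
qed (use n_in r_n_notin_D in \<open>auto simp: D_def\<close>)

definition S where "S z = subtree \<Delta> n {n, z}"

lemma S_sel:
  assumes "z \<in> I"
  shows "vertices (S z) = insert n (D z)" "edges (S z) = {e \<in> E. e \<subseteq> insert n (D z)}"
    "root_vertex (S z) = n" "weight (S z) = weight \<Delta>"
proof -
  have "{x \<in> V. {n, z} \<in> path_edges (T x)} = D z"
    using down_edge_in_path[OF assms] by (auto simp: D_def)
  then show "vertices (S z) = insert n (D z)" "edges (S z) = {e \<in> E. e \<subseteq> insert n (D z)}"
    "root_vertex (S z) = n" "weight (S z) = weight \<Delta>"
    by (simp_all add: S_def subtree_def Let_def)
qed

text \<open>An edge at a descendant of \<open>z\<close> leads to another descendant or, from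
  \<open>z\<close> itself, up to \<open>n\<close>. So no edge at such a vertex is lost in the
  branch, and valencies are unchanged.\<close>

lemma edge_at_D:
  assumes "z \<in> I" "x \<in> D z" "e \<in> E" "x \<in> e"
  shows "e \<in> edges (S z)"
proof -
  obtain y where y: "e = {x, y}" using edge_at assms by metis
  have V: "x \<in> V" "y \<in> V" using edgeD assms y by auto
  have "T y = T x @ [y] \<or> T x = T y @ [x]" using T_edge assms y by blast
  then have "y \<in> insert n (D z)"
  proof
    assume "T y = T x @ [y]"
    then show ?thesis using V assms(2) by (auto simp: D_def)
  next
    assume *: "T x = T y @ [x]"
    show ?thesis
    proof (cases "z = x")
      case True
      then have "T y = [r, n]" using * T_child[OF assms(1)] by simp
      then show ?thesis using T_last[OF V(2)] by simp
    next
      case False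
      then show ?thesis using * assms(2) V by (auto simp: D_def)
    qed
  qed
  then show ?thesis using y assms by (auto simp: S_sel)
qed

lemma edges_S_n:
  assumes "z \<in> I"
  shows "{e \<in> edges (S z). n \<in> e} = {{n, z}}"
proof (intro equalityI subsetI)
  fix e assume "e \<in> {e \<in> edges (S z). n \<in> e}"
  then have e: "e \<in> E" "n \<in> e" "e \<subseteq> insert n (D z)" using S_sel[OF assms] by auto
  then obtain y where y: "e = {n, y}" "y \<noteq> n" using edge_at by metis
  then have yD: "y \<in> D z" using e by auto
  then obtain q where q: "T y = r # n # z # q" using T_D assms by blast
  then have "q = []" using T_edge[of n y] e y T_n by auto
  then have "y = z" using q T_last[of y] yD by (simp add: D_def)
  then show "e \<in> {{n, z}}" using y by simp
next
  fix e assume "e \<in> {{n, z}}"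
  moreover have "z \<in> D z" using childrenD[OF assms] T_child[OF assms] by (simp add: D_def)
  ultimately show "e \<in> {e \<in> edges (S z). n \<in> e}"
    using assms S_sel[OF assms] by (auto simp: children_def)
qed

text \<open>From \<open>z\<close> on, every vertex of the path is a descendant of \<open>z\<close>,
  so dropping \<open>r\<close> leaves a path inside the branch. By uniqueness all notions defined
  through \<open>shortest_path\<close> can then be compared.\<close>

lemma path_S:
  assumes "z \<in> I" "x \<in> insert n (D z)"
  shows "is_path (S z) n (tl (T x)) x"
proof (cases "x = n")
  case True
  then show ?thesis by (simp add: T_n is_path_iff S_sel[OF assms(1)])
next
  case False
  then have x: "x \<in> D z" "x \<in> V" using assms by (auto simp: D_def)
  obtain q where q: "T x = r # n # z # q" using T_D assms(1) x by blast
  have D: "y \<in> D z" if y: "y \<in> set (z # q)" for y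
  proof -
    obtain q1 q2 where "z # q = q1 @ y # q2" using split_list[OF y] by blast
    then have Tx: "T x = (r # n # q1) @ y # q2" and "q1 = [] \<and> y = z \<or> z \<in> set q1"
      using q by (auto simp: Cons_eq_append_conv)
    then have "z \<in> set (T y)" unfolding T_prefix[OF x(2) Tx] by auto
    then show ?thesis using T_subset[OF x(2)] q y by (auto simp: D_def)
  qed
  have "is_path \<Delta> n (n # z # q) x" using T_path[OF x(2)] unfolding q is_path_Cons by simp
  moreover have "successively (\<lambda>x y. {x, y} \<in> edges (S z)) (n # z # q)"
    if "successively (\<lambda>x y. {x, y} \<in> E) (n # z # q)"
    using that D S_sel[OF assms(1)]
    by (elim successively_mono) auto
  ultimately show ?thesis unfolding q is_path_iff using D S_sel[OF assms(1)] by auto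
qed

lemma finite_tree_S:
  assumes "z \<in> I"
  shows "finite_tree (S z)"
  unfolding finite_tree_def
proof (intro conjI ballI)
  have sub: "vertices (S z) \<subseteq> V" "edges (S z) \<subseteq> E" using S_sel[OF assms] n_in by (auto simp: D_def)
  show "finite (vertices (S z))" using sub(1) finite_V finite_subset by blast
  show "vertices (S z) \<noteq> {}" using S_sel[OF assms] by simp
  show "e \<subseteq> vertices (S z)" if "e \<in> edges (S z)" for e using that S_sel[OF assms] by auto
  show "card e = 2" if "e \<in> edges (S z)" for e
    using that sub(2) finite_tree by (auto simp: finite_tree_def)
  show "\<exists>p. is_path (S z) u p v" if "u \<in> vertices (S z)" "v \<in> vertices (S z)" for u v
    using that path_S[OF assms] is_path_rev is_path_trans unfolding S_sel[OF assms] by meson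
  have "is_path \<Delta> u p v" if "is_path (S z) u p v" for u p v
    using that sub unfolding is_path_def by blast
  note path = this
  show "\<nexists>u v p. is_path (S z) u p v \<and> 3 \<le> length p \<and> {v, u} \<in> edges (S z)"
  proof clarify
    fix u v p assume "is_path (S z) u p v" "3 \<le> length p" "{v, u} \<in> edges (S z)"
    then have "is_path \<Delta> u p v" "3 \<le> length p" "{v, u} \<in> E" using path sub(2) by auto
    then show False using finite_tree unfolding finite_tree_def by blast
  qed
qed

lemma T_S:
  assumes "z \<in> I" "x \<in> insert n (D z)"
  shows "shortest_path (S z) n x = tl (T x)"
  using shortest_path_eq[OF finite_tree_S path_S] assms by blast

lemma T_eq_Cons:
  assumes "z \<in> I" "x \<in> insert n (D z)"
  shows "T x = r # tl (T x)" "path_edges (T x) = insert {r, n} (path_edges (tl (T x)))"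
proof -
  have "x \<in> V" "x \<noteq> r" using assms n_in r_n_notin_D by (auto simp: D_def)
  then obtain p where "T x = r # n # p" using T_nonroot by blast
  then show "T x = r # tl (T x)" "path_edges (T x) = insert {r, n} (path_edges (tl (T x)))"
    by (simp_all add: path_edges_Cons)
qed

lemma root_edge_notin_S: "z \<in> I \<Longrightarrow> {r, n} \<notin> edges (S z)"
  using S_sel r_n_notin_D n_in by auto

lemma valency_S_n: "z \<in> I \<Longrightarrow> valency (S z) n = 1"
  using edges_S_n by (simp add: valency_def)

lemma edges_S_at_D: "z \<in> I \<Longrightarrow> x \<in> D z \<Longrightarrow> {e \<in> edges (S z). x \<in> e} = {e \<in> E. x \<in> e}"
  using edge_at_D S_sel by auto

lemma valency_S: "z \<in> I \<Longrightarrow> x \<in> D z \<Longrightarrow> valency (S z) x = valency \<Delta> x"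
  by (simp add: valency_def edges_S_at_D)

lemma down_edges_S:
  assumes "z \<in> I" "x \<in> D z"
  shows "down_edges (S z) x = down_edges \<Delta> x"
proof -
  have "down_edges (S z) x = {e \<in> edges (S z). x \<in> e} - path_edges (tl (T x))"
    using assms by (auto simp: down_edges_def S_sel T_S)
  also have "\<dots> = {e \<in> edges (S z). x \<in> e} - path_edges (T x)"
    using T_eq_Cons[of z x] assms root_edge_notin_S[of z] by auto
  also have "\<dots> = down_edges \<Delta> x"
    unfolding edges_S_at_D[OF assms] by (auto simp: down_edges_def)
  finally show ?thesis .
qed

lemma weighted_rooted_tree_S:
  assumes "z \<in> I"
  shows "weighted_rooted_tree (S z)"
  unfolding weighted_rooted_tree_def S_sel[OF assms]
proof (intro conjI ballI impI)
  show "valency (S z) n = 1" using valency_S_n assms by simp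
  show "weight \<Delta> e > 0" if "e \<in> {e \<in> E. e \<subseteq> insert n (D z)}" for e
  proof -
    have "e \<in> E" "r \<notin> e" using that r_n_notin_D n_in assms by auto
    then show ?thesis using weighted_rooted_tree by (auto simp: weighted_rooted_tree_def)
  qed
  show "pairwise (\<lambda>e e'. coprime (weight \<Delta> e) (weight \<Delta> e')) (down_edges (S z) x)"
    if "x \<in> insert n (D z) - {n}" for x
  proof -
    have "x \<in> D z" "x \<in> V" "x \<noteq> r" using that r_n_notin_D assms by (auto simp: D_def)
    then show ?thesis using weighted_rooted_tree down_edges_S[OF assms] by (simp add: weighted_rooted_tree_def)
  qed
qed (use finite_tree_S assms in auto)

text \<open>Whatever is reached through \<open>e\<close> lies below \<open>x\<close>, hence in
  \<open>D z\<close>, so \<open>e\<close> cuts off the same piece of the branch and of the whole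
  tree. This lets the semigroup condition pass to branches.\<close>

lemma subtree_S:
  assumes "z \<in> I" "x \<in> D z" "e \<in> down_edges \<Delta> x"
  shows "subtree (S z) x e = subtree \<Delta> x e"
proof -
  have x: "x \<in> V" "x \<noteq> n" using assms r_n_notin_D by (auto simp: D_def)
  obtain y where y: "e = {x, y}" "y \<in> children x" using assms(3) down_edges_eq[OF x(1)] by auto
  have "x \<noteq> r" using assms r_n_notin_D by blast
  then have e_ne: "e \<noteq> {r, n}" using y x by (auto simp: doubleton_eq_iff)
  have inD: "v \<in> D z" if "v \<in> V" "e \<in> path_edges (T v)" for v
  proof -
    have "x \<in> set (T v)" using path_edges_subset[OF that(2)] y by auto
    then show ?thesis using T_trans[OF that(1)] assms(2) that(1) by (auto simp: D_def)
  qed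
  have "{v \<in> vertices (S z). e \<in> path_edges (shortest_path (S z) (root_vertex (S z)) v)}
      = {v \<in> insert n (D z). e \<in> path_edges (T v)}"
    using assms(1) T_S T_eq_Cons(2) e_ne by (auto simp: S_sel)
  also have "\<dots> = {v \<in> V. e \<in> path_edges (T v)}" (is "_ = ?W")
    using inD n_in by (auto simp: D_def)
  finally have W: "{v \<in> vertices (S z). e \<in> path_edges (shortest_path (S z) (root_vertex (S z)) v)} = ?W" .
  have "insert x ?W \<subseteq> insert n (D z)" using inD assms(2) by auto
  then have "{e' \<in> edges (S z). e' \<subseteq> insert x ?W} = {e' \<in> E. e' \<subseteq> insert x ?W}"
    using assms(1) by (auto simp: S_sel)
  then show ?thesis unfolding subtree_def W Let_def by (simp add: S_sel assms(1))
qed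

lemma card_vertices_S: "z \<in> I \<Longrightarrow> card (vertices (S z)) < card V"
proof (rule psubset_card_mono[OF finite_V])
  assume z: "z \<in> I"
  have "r \<notin> vertices (S z)" using S_sel[OF z] r_n_notin_D[OF z] n_in by simp
  moreover have "vertices (S z) \<subseteq> V" using S_sel[OF z] n_in by (auto simp: D_def)
  ultimately show "vertices (S z) \<subset> V" using root_in by blast
qed

definition a where "a z = weight \<Delta> {n, z}"

lemma a_pos: "z \<in> I \<Longrightarrow> a z > 0"
  using weighted_rooted_tree n_in I_neq[of z] unfolding a_def weighted_rooted_tree_def children_def
  by (metis (no_types, lifting) insertE mem_Collect_eq singletonD)

lemma a_coprime: "z \<in> I \<Longrightarrow> z' \<in> I \<Longrightarrow> z \<noteq> z' \<Longrightarrow> coprime (a z) (a z')"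
proof -
  assume z: "z \<in> I" "z' \<in> I" "z \<noteq> z'"
  then have "{n, z} \<noteq> {n, z'}" by (auto simp: doubleton_eq_iff)
  moreover have "pairwise (\<lambda>e e'. coprime (weight \<Delta> e) (weight \<Delta> e')) (down_edges \<Delta> n)"
    using weighted_rooted_tree n_in by (auto simp: weighted_rooted_tree_def)
  ultimately show ?thesis using z unfolding down_edges_eq[OF n_in(1)] by (auto simp: pairwise_def a_def)
qed

lemma path_edges_r_n: "path_edges [r, n] = {{r, n}}"
  by (simp add: path_edges_Cons) (simp add: path_edges_def)

lemma down_edges_n: "down_edges \<Delta> n = {e \<in> E. n \<in> e \<and> e \<noteq> {r, n}}"
  by (simp add: down_edges_def T_n path_edges_r_n)

lemma edges_at_n: "{e \<in> E. n \<in> e} = insert {r, n} (down_edges \<Delta> n)" "{r, n} \<notin> down_edges \<Delta> n"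
  using n_edge by (auto simp: down_edges_n)

lemma valency_n: "valency \<Delta> n = card I + 1"
proof -
  have "finite (down_edges \<Delta> n)" using finite_E by (simp add: down_edges_def)
  then show ?thesis unfolding valency_def edges_at_n(1) using edges_at_n(2)
    by (simp add: down_edges_eq[OF n_in(1)] card_image[OF inj_on_edge])
qed

lemma prod_down_edges: "J \<subseteq> I \<Longrightarrow> (\<Prod>e\<in>(\<lambda>z. {n, z}) ` J. weight \<Delta> e) = (\<Prod>z\<in>J. a z)"
  by (subst prod.reindex) (auto simp: a_def intro: inj_on_subset[OF inj_on_edge])

lemma ell_n: "ell \<Delta> n = (\<Prod>z\<in>I. a z)"
proof -
  have "{e \<in> E. e \<inter> {r, n} \<noteq> {} \<and> e \<notin> {{r, n}}} = down_edges \<Delta> n"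
    unfolding down_edges_n using root_edge_unique by blast
  then show ?thesis
    using prod_down_edges[of I] by (simp add: ell_def Let_def path_edges_r_n T_n down_edges_eq[OF n_in(1)])
qed

text \<open>The edges adjacent to the path are those inside the branch, which give
  \<open>ell (S z) x\<close>, and the edges from \<open>n\<close> to the other children, which the
  branch does not contain. The latter are the origin of the cofactors in
  \<open>glue_family\<close>.\<close>

lemma ell_S:
  assumes "z \<in> I" "x \<in> D z"
  shows "ell \<Delta> x = (\<Prod>z'\<in>I - {z}. a z') * ell (S z) x"
proof -
  let ?p = "tl (T x)"
  let ?A = "{e \<in> edges (S z). e \<inter> set ?p \<noteq> {} \<and> e \<notin> path_edges ?p}"
  let ?B = "(\<lambda>z. {n, z}) ` (I - {z})"
  obtain q where q: "T x = r # n # z # q" using T_D assms by blast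
  have T: "T x = r # ?p" "path_edges (T x) = insert {r, n} (path_edges ?p)"
    using T_eq_Cons assms by auto
  have pS: "is_path (S z) n ?p x" using path_S assms by blast
  have pD: "set ?p \<subseteq> insert n (D z)" using pS S_sel[OF assms(1)] by (simp add: is_path_iff)
  have nz: "{n, z} \<in> path_edges ?p" by (simp add: q path_edges_Cons)
  have B_disj: "?B \<inter> edges (S z) = {}"
  proof -
    have "{n, z'} \<notin> edges (S z)" if "z' \<in> I - {z}" for z'
    proof
      assume "{n, z'} \<in> edges (S z)"
      then have "{n, z'} \<in> {e \<in> edges (S z). n \<in> e}" by simp
      then have "{n, z'} = {n, z}" unfolding edges_S_n[OF assms(1)] by simp
      then show False using that by (auto simp: doubleton_eq_iff)
    qed
    then show ?thesis by blast
  qed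
  have path_in: "path_edges ?p \<subseteq> edges (S z)"
    using pS by (auto simp: is_path_def path_edges_def)
  have "{e \<in> E. e \<inter> set (T x) \<noteq> {} \<and> e \<notin> path_edges (T x)} = ?A \<union> ?B"
  proof (intro equalityI subsetI)
    fix e assume "e \<in> {e \<in> E. e \<inter> set (T x) \<noteq> {} \<and> e \<notin> path_edges (T x)}"
    then have e: "e \<in> E" "e \<inter> set (T x) \<noteq> {}" "e \<noteq> {r, n}" "e \<notin> path_edges ?p"
      using T(2) by auto
    have "r \<notin> e" using e root_edge_unique by blast
    then have ep: "e \<inter> set ?p \<noteq> {}" using e(2) by (subst (asm) T(1)) auto
    show "e \<in> ?A \<union> ?B"
    proof (cases "e \<inter> D z = {}")
      case False
      then show ?thesis using edge_at_D[OF assms(1)] e ep by auto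
    next
      case True
      then have "n \<in> e" using ep pD by auto
      then have "e \<in> down_edges \<Delta> n" using e by (simp add: down_edges_n)
      then obtain z' where "z' \<in> I" "e = {n, z'}" using down_edges_eq[OF n_in(1)] by auto
      then show ?thesis using e(4) nz by blast
    qed
  next
    fix e assume "e \<in> ?A \<union> ?B"
    then show "e \<in> {e \<in> E. e \<inter> set (T x) \<noteq> {} \<and> e \<notin> path_edges (T x)}"
    proof
      assume "e \<in> ?A"
      moreover have "set ?p \<subseteq> set (T x)" by (simp add: q subset_iff)
      ultimately show ?thesis using T(2) root_edge_notin_S[OF assms(1)] S_sel(2)[OF assms(1)] by auto
    next
      assume e: "e \<in> ?B"
      then have "e \<in> E" "n \<in> e" "e \<noteq> {r, n}" using children_root
        by (auto simp: children_def doubleton_eq_iff)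
      moreover have "e \<notin> path_edges ?p" using e path_in B_disj by blast
      moreover have "n \<in> set (T x)" by (simp add: q)
      ultimately show ?thesis using T(2) by auto
    qed
  qed
  then have "ell \<Delta> x = (\<Prod>e\<in>?A \<union> ?B. weight \<Delta> e)" by (simp add: ell_def Let_def)
  also have "\<dots> = (\<Prod>e\<in>?A. weight \<Delta> e) * (\<Prod>e\<in>?B. weight \<Delta> e)"
  proof (rule prod.union_disjoint)
    show "finite ?A" using finite_E S_sel(2)[OF assms(1)] by simp
    show "finite ?B" using finite_children by simp
    show "?A \<inter> ?B = {}" using B_disj by auto
  qed
  also have "(\<Prod>e\<in>?A. weight \<Delta> e) = ell (S z) x"
    using assms by (simp add: ell_def Let_def S_sel(3,4) T_S)
  also have "(\<Prod>e\<in>?B. weight \<Delta> e) = (\<Prod>z'\<in>I - {z}. a z')"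
    by (rule prod_down_edges) auto
  finally show ?thesis by (simp add: mult.commute)
qed

lemma leaves_eq: "leaves \<Delta> = (if I = {} then {n} else \<Union>z\<in>I. leaves (S z))"
proof -
  have "leaves \<Delta> = {x \<in> V - {r}. valency \<Delta> x = 1}" by (auto simp: leaves_def)
  also have "\<dots> = (if I = {} then {n} else {}) \<union> (\<Union>z\<in>I. {x \<in> D z. valency \<Delta> x = 1})"
    unfolding V_partition using valency_n finite_children by auto
  also have "(\<Union>z\<in>I. {x \<in> D z. valency \<Delta> x = 1}) = (\<Union>z\<in>I. leaves (S z))"
    using valency_S S_sel r_n_notin_D by (auto simp: leaves_def)
  finally show ?thesis by auto
qed

lemma leaves_S_subset: "z \<in> I \<Longrightarrow> leaves (S z) \<subseteq> D z"
  using S_sel by (auto simp: leaves_def)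

text \<open>On a branch valencies are unchanged and \<open>ell\<close> is multiplied by a constant,
  so the branch contributes that constant times its own \<mu> - 1. The vertex \<open>n\<close>,
  being the root of every branch, is counted in none of them.\<close>

lemma tree_mu_eq: "tree_mu \<Delta> = family_mu I a (\<lambda>z. tree_mu (S z))"
proof -
  let ?t = "\<lambda>x. (int (valency \<Delta> x) - 2) * int (ell \<Delta> x)"
  have finD: "finite (D z)" for z using finite_V by (simp add: D_def)
  have S: "(\<Sum>x\<in>D z. ?t x) = int (\<Prod>j\<in>I - {z}. a j) * (tree_mu (S z) - 1)" if z: "z \<in> I" for z
  proof -
    have "tree_mu (S z) - 1 = (\<Sum>x\<in>D z. (int (valency \<Delta> x) - 2) * int (ell (S z) x))"
      using r_n_notin_D(2)[OF z] valency_S[OF z] by (simp add: tree_mu_def S_sel[OF z])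
    then show ?thesis using ell_S[OF z] by (simp add: sum_distrib_left algebra_simps)
  qed
  have "tree_mu \<Delta> = 1 + (\<Sum>x\<in>insert n (\<Union>z\<in>I. D z). ?t x)"
    unfolding tree_mu_def V_partition ..
  also have "\<dots> = 1 + ?t n + (\<Sum>x\<in>(\<Union>z\<in>I. D z). ?t x)"
    using r_n_notin_D finD finite_children by (subst sum.insert) auto
  also have "(\<Sum>x\<in>(\<Union>z\<in>I. D z). ?t x) = (\<Sum>z\<in>I. \<Sum>x\<in>D z. ?t x)"
    using finD finite_children D_disjoint by (intro sum.UNION_disjoint) auto
  finally show ?thesis
    using S by (simp add: family_mu_def valency_n ell_n)
qed

lemma semigroup_condition_eq:
  "semigroup_condition \<Delta> \<longleftrightarrow> (\<forall>z\<in>I. a z \<in> sg (S z) \<and> semigroup_condition (S z))"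
proof -
  have "semigroup_condition \<Delta> \<longleftrightarrow> (\<forall>e\<in>down_edges \<Delta> n. weight \<Delta> e \<in> sg (subtree \<Delta> n e)) \<and>
    (\<forall>z\<in>I. \<forall>x\<in>D z. \<forall>e\<in>down_edges \<Delta> x. weight \<Delta> e \<in> sg (subtree \<Delta> x e))"
    unfolding semigroup_condition_def V_partition by auto
  also have "(\<forall>e\<in>down_edges \<Delta> n. weight \<Delta> e \<in> sg (subtree \<Delta> n e)) \<longleftrightarrow> (\<forall>z\<in>I. a z \<in> sg (S z))"
    by (simp add: down_edges_eq[OF n_in(1)] a_def S_def)
  also have "(\<forall>z\<in>I. \<forall>x\<in>D z. \<forall>e\<in>down_edges \<Delta> x. weight \<Delta> e \<in> sg (subtree \<Delta> x e)) \<longleftrightarrow>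
    (\<forall>z\<in>I. semigroup_condition (S z))"
  proof (rule ball_cong[OF refl])
    fix z assume z: "z \<in> I"
    have "vertices (S z) - {root_vertex (S z)} = D z" using S_sel[OF z] r_n_notin_D[OF z] by auto
    then show "(\<forall>x\<in>D z. \<forall>e\<in>down_edges \<Delta> x. weight \<Delta> e \<in> sg (subtree \<Delta> x e)) \<longleftrightarrow> semigroup_condition (S z)"
      using z by (simp add: semigroup_condition_def S_sel(4) down_edges_S subtree_S)
  qed
  finally show ?thesis by blast
qed

text \<open>As \<open>n\<close> has valency \<open>card I + 1\<close>, it has no child or at least
  two, the range in which equality controls the weights.\<close>

lemma no_valency_2_S:
  assumes "no_valency_2 \<Delta>"
  shows "card I \<noteq> 1" "z \<in> I \<Longrightarrow> no_valency_2 (S z)"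
proof -
  show "card I \<noteq> 1" using assms valency_n n_in by (auto simp: no_valency_2_def)
  show "no_valency_2 (S z)" if "z \<in> I"
    using assms that valency_S valency_S_n S_sel(1) by (auto simp: no_valency_2_def D_def)
qed

end

section \<open>Polynomials on a set of variables\<close>

text \<open>Arbitrary sets of variables are allowed so that two algebras can be put on disjoint sets
  and joined.\<close>

definition mpolys :: "nat set \<Rightarrow> cmpoly set" where
  "mpolys V = {p. \<forall>m\<in>Poly_Mapping.keys p. Poly_Mapping.keys m \<subseteq> V}"

definition restr :: "nat set \<Rightarrow> (nat \<Rightarrow>\<^sub>0 nat) \<Rightarrow> (nat \<Rightarrow>\<^sub>0 nat)" where
  "restr Y m = Abs_poly_mapping (\<lambda>i. if i \<in> Y then Poly_Mapping.lookup m i else 0)"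

lemma lookup_restr [simp]: "Poly_Mapping.lookup (restr Y m) i = (if i \<in> Y then Poly_Mapping.lookup m i else 0)"
proof -
  have "finite {i. (if i \<in> Y then Poly_Mapping.lookup m i else 0) \<noteq> 0}"
    by (rule finite_subset[OF _ finite_lookup[of m]]) auto
  then show ?thesis by (simp add: restr_def)
qed

lemma keys_restr [simp]: "Poly_Mapping.keys (restr Y m) = Poly_Mapping.keys m \<inter> Y"
  by (auto simp: in_keys_iff split: if_splits)

lemma restr_add: "restr Y (m + m') = restr Y m + restr Y m'"
  by (rule poly_mapping_eqI) (simp add: lookup_add)

lemma restr_id: "Poly_Mapping.keys m \<subseteq> Y \<Longrightarrow> restr Y m = m"
  by (rule poly_mapping_eqI) (auto simp: in_keys_iff)

lemma restr_zero: "Poly_Mapping.keys m \<inter> Y = {} \<Longrightarrow> restr Y m = 0"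
  by (rule poly_mapping_eqI) (auto simp: in_keys_iff)

lemma restr_restr [simp]: "restr Y (restr Z m) = restr (Y \<inter> Z) m"
  by (rule poly_mapping_eqI) auto

lemma restr_split: "Poly_Mapping.keys m \<subseteq> X \<union> Y \<Longrightarrow> X \<inter> Y = {} \<Longrightarrow> m = restr X m + restr Y m"
  by (rule poly_mapping_eqI) (auto simp: lookup_add in_keys_iff)

lemma restr_empty [simp]: "restr {} m = 0"
  by (rule restr_zero) simp

lemma keys_plus_nat: "Poly_Mapping.keys (m + m') = Poly_Mapping.keys m \<union> Poly_Mapping.keys (m' :: nat \<Rightarrow>\<^sub>0 nat)"
  by (auto simp: in_keys_iff lookup_add)

lemma mpolys_zero [simp]: "0 \<in> mpolys V"
  by (simp add: mpolys_def)

lemma mpolys_one [simp]: "1 \<in> mpolys V"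
  by (simp add: mpolys_def)

lemma mpolys_add: "p \<in> mpolys V \<Longrightarrow> q \<in> mpolys V \<Longrightarrow> p + q \<in> mpolys V"
  using keys_add[of p q] by (auto simp: mpolys_def)

lemma mpolys_uminus: "p \<in> mpolys V \<Longrightarrow> - p \<in> mpolys V"
  by (simp add: mpolys_def in_keys_iff)

lemma mpolys_diff: "p \<in> mpolys V \<Longrightarrow> q \<in> mpolys V \<Longrightarrow> p - q \<in> mpolys V"
  using mpolys_add[of p V "- q"] mpolys_uminus[of q] by simp

lemma mpolys_mult: "p \<in> mpolys V \<Longrightarrow> q \<in> mpolys V \<Longrightarrow> p * q \<in> mpolys V"
  using keys_mult[of p q] by (fastforce simp: mpolys_def keys_plus_nat)

lemma mpolys_single: "Poly_Mapping.keys m \<subseteq> V \<Longrightarrow> Poly_Mapping.single m c \<in> mpolys V"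
  by (simp add: mpolys_def)

lemma mpolys_sum: "(\<And>i. i \<in> A \<Longrightarrow> f i \<in> mpolys V) \<Longrightarrow> sum f A \<in> mpolys V"
  by (induction A rule: infinite_finite_induct) (auto intro: mpolys_add)

lemma mpolys_mono: "V \<subseteq> W \<Longrightarrow> mpolys V \<subseteq> mpolys W"
  by (auto simp: mpolys_def)

lemma poly_mapping_sum_single:
  fixes p :: cmpoly
  assumes "finite S" "Poly_Mapping.keys p \<subseteq> S"
  shows "(\<Sum>m\<in>S. Poly_Mapping.single m (Poly_Mapping.lookup p m)) = p"
proof (rule poly_mapping_eqI)
  fix k
  have "Poly_Mapping.lookup (\<Sum>m\<in>S. Poly_Mapping.single m (Poly_Mapping.lookup p m)) k = (\<Sum>m\<in>S. if k = m then Poly_Mapping.lookup p m else 0)"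
    by (simp add: lookup_sum lookup_single when_def eq_commute cong: if_cong)
  also have "\<dots> = Poly_Mapping.lookup p k" using assms by (auto simp: in_keys_iff)
  finally show "Poly_Mapping.lookup (\<Sum>m\<in>S. Poly_Mapping.single m (Poly_Mapping.lookup p m)) k = Poly_Mapping.lookup p k" .
qed

lemma mpolys_induct [consumes 1, case_names zero add]:
  assumes "p \<in> mpolys V" "P 0"
    and "\<And>m c p. Poly_Mapping.keys m \<subseteq> V \<Longrightarrow> p \<in> mpolys V \<Longrightarrow> P p \<Longrightarrow> P (Poly_Mapping.single m c + p)"
  shows "P p"
proof -
  have "P (\<Sum>m\<in>S. Poly_Mapping.single m (Poly_Mapping.lookup p m))" if "finite S" "S \<subseteq> Poly_Mapping.keys p" for S
    using that
  proof (induction S rule: finite_induct)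
    case (insert m S)
    have "Poly_Mapping.keys k \<subseteq> V" if "k \<in> insert m S" for k
      using that insert(4) assms(1) by (auto simp: mpolys_def)
    then show ?case using insert by (auto intro!: assms(3) mpolys_sum mpolys_single)
  qed (simp add: assms)
  from this[of "Poly_Mapping.keys p"] show ?thesis by (simp add: poly_mapping_sum_single)
qed

lemma mpolys_UNIV: "p \<in> mpolys UNIV"
  by (simp add: mpolys_def)

section \<open>Ideals\<close>

text \<open>The set of variables is a parameter because the same generators are reused in larger
  polynomial rings. \<open>genideal_eq\<close> identifies the result with the usual generated
  ideal.\<close>

inductive_set ideal_of :: "nat set \<Rightarrow> cmpoly set \<Rightarrow> cmpoly set" for V F where
  zero: "0 \<in> ideal_of V F"
| step: "p \<in> ideal_of V F \<Longrightarrow> f \<in> F \<Longrightarrow> q \<in> mpolys V \<Longrightarrow> q * f + p \<in> ideal_of V F"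

lemma ideal_of_add: "p \<in> ideal_of V F \<Longrightarrow> q \<in> ideal_of V F \<Longrightarrow> p + q \<in> ideal_of V F"
  by (induction p rule: ideal_of.induct) (auto simp: add.assoc intro: ideal_of.step)

lemma ideal_of_mult: "p \<in> ideal_of V F \<Longrightarrow> q \<in> mpolys V \<Longrightarrow> q * p \<in> ideal_of V F"
proof (induction p rule: ideal_of.induct)
  case (step p f q')
  have "q * (q' * f + p) = (q * q') * f + q * p" by (simp add: algebra_simps)
  then show ?case using step by (auto intro: ideal_of.step mpolys_mult)
qed (auto intro: ideal_of.zero)

lemma ideal_of_gen: "f \<in> F \<Longrightarrow> f \<in> ideal_of V F"
  using ideal_of.step[OF ideal_of.zero, of f F 1 V] by simp

lemma ideal_of_uminus: "p \<in> ideal_of V F \<Longrightarrow> - p \<in> ideal_of V F"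
  using ideal_of_mult[of p V F "- 1"] mpolys_uminus[of 1 V] by simp

lemma ideal_of_sum: "(\<And>i. i \<in> A \<Longrightarrow> f i \<in> ideal_of V F) \<Longrightarrow> sum f A \<in> ideal_of V F"
  by (induction A rule: infinite_finite_induct) (auto intro: ideal_of_add ideal_of.zero)

lemma ideal_of_mono: "V \<subseteq> W \<Longrightarrow> F \<subseteq> F' \<Longrightarrow> ideal_of V F \<subseteq> ideal_of W F'"
proof
  fix p assume "V \<subseteq> W" "F \<subseteq> F'" "p \<in> ideal_of V F"
  from this(3) show "p \<in> ideal_of W F'"
  proof (induction p rule: ideal_of.induct)
    case (step p f q)
    then have "f \<in> F'" "q \<in> mpolys W" using \<open>V \<subseteq> W\<close> \<open>F \<subseteq> F'\<close> mpolys_mono by blast+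
    then show ?case using step by (intro ideal_of.step)
  qed (rule ideal_of.zero)
qed

lemma ideal_of_subset: "F \<subseteq> mpolys V \<Longrightarrow> ideal_of V F \<subseteq> mpolys V"
proof
  fix p assume "F \<subseteq> mpolys V" "p \<in> ideal_of V F"
  from this(2) show "p \<in> mpolys V"
    by (induction p rule: ideal_of.induct) (use \<open>F \<subseteq> mpolys V\<close> in \<open>auto intro: mpolys_add mpolys_mult\<close>)
qed

lemma ideal_of_empty [simp]: "ideal_of V {} = {0}"
proof -
  have "p = 0" if "p \<in> ideal_of V {}" for p using that by (induction p rule: ideal_of.induct) auto
  then show ?thesis using ideal_of.zero by blast
qed

text \<open>The part of a polynomial whose exponent vectors lie in \<open>A\<close>, with all variables outside
  \<open>Y\<close> set to 1. When \<open>A\<close> is a fibre of a grading that ignores \<open>Y\<close>, this is a component of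
  the polynomial in the corresponding grading, viewed as a polynomial on \<open>Y\<close>.\<close>

definition part :: "(nat \<Rightarrow>\<^sub>0 nat) set \<Rightarrow> nat set \<Rightarrow> cmpoly \<Rightarrow> cmpoly" where
  "part A Y p = (\<Sum>m\<in>Poly_Mapping.keys p \<inter> A. Poly_Mapping.single (restr Y m) (Poly_Mapping.lookup p m))"

lemma part_superset:
  assumes "finite S" "Poly_Mapping.keys p \<subseteq> S"
  shows "part A Y p = (\<Sum>m\<in>S \<inter> A. Poly_Mapping.single (restr Y m) (Poly_Mapping.lookup p m))"
  unfolding part_def using assms by (intro sum.mono_neutral_left) (auto simp: in_keys_iff)

lemma part_add: "part A Y (p + q) = part A Y p + part A Y q"
proof -
  let ?S = "Poly_Mapping.keys p \<union> Poly_Mapping.keys q"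
  have "part A Y (p + q) = (\<Sum>m\<in>?S \<inter> A. Poly_Mapping.single (restr Y m) (Poly_Mapping.lookup (p + q) m))"
    using keys_add[of p q] by (intro part_superset) auto
  also have "\<dots> = (\<Sum>m\<in>?S \<inter> A. Poly_Mapping.single (restr Y m) (Poly_Mapping.lookup p m)) + (\<Sum>m\<in>?S \<inter> A. Poly_Mapping.single (restr Y m) (Poly_Mapping.lookup q m))"
    by (simp add: lookup_add single_add sum.distrib)
  also have "\<dots> = part A Y p + part A Y q"
    using part_superset[of ?S p A Y] part_superset[of ?S q A Y] by simp
  finally show ?thesis .
qed

lemma part_zero [simp]: "part A Y 0 = 0"
  by (simp add: part_def)

lemma part_uminus: "part A Y (- p) = - part A Y p"
  using part_add[of A Y p "- p"] by (simp add: eq_neg_iff_add_eq_0 add.commute)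

lemma part_diff: "part A Y (p - q) = part A Y p - part A Y q"
  using part_add[of A Y p "- q"] by (simp add: part_uminus)

lemma part_sum: "part A Y (sum f B) = (\<Sum>i\<in>B. part A Y (f i))"
  by (induction B rule: infinite_finite_induct) (auto simp: part_add)

lemma part_single: "part A Y (Poly_Mapping.single m c) = (if m \<in> A then Poly_Mapping.single (restr Y m) c else 0)"
  by (simp add: part_def)

lemma part_in_mpolys: "part A Y p \<in> mpolys Y"
  unfolding part_def by (intro mpolys_sum mpolys_single) simp

lemma part_empty [simp]: "part {} Y p = 0"
  by (simp add: part_def)

lemma part_cong: "(\<And>m. m \<in> Poly_Mapping.keys p \<Longrightarrow> m \<in> A \<longleftrightarrow> m \<in> B) \<Longrightarrow> part A Y p = part B Y p"
  unfolding part_def by (intro sum.cong) auto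

lemma part_disjoint:
  assumes "p \<in> mpolys X" "X \<inter> Y = {}"
  shows "part A Y p = part A {} p"
  unfolding part_def
proof (rule sum.cong[OF refl])
  fix m assume "m \<in> Poly_Mapping.keys p \<inter> A"
  then have "Poly_Mapping.keys m \<inter> Y = {}" using assms by (auto simp: mpolys_def)
  then show "Poly_Mapping.single (restr Y m) (Poly_Mapping.lookup p m) = Poly_Mapping.single (restr {} m) (Poly_Mapping.lookup p m)" by (simp add: restr_zero)
qed

lemma part_single_mult: "part A Y (Poly_Mapping.single u c * p) = Poly_Mapping.single (restr Y u) c * part {m. u + m \<in> A} Y p"
  using mpolys_UNIV[of p]
proof (induction p rule: mpolys_induct)
  case (add m c' p)
  then show ?case
    by (simp add: distrib_left part_add mult_single part_single restr_add)
qed simp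

text \<open>The components of a grading that ignores \<open>Y\<close> are modules over the
  polynomials on \<open>Y\<close>, so multiplication by such a polynomial can be studied component
  by component.\<close>

lemma part_mult:
  assumes "f \<in> mpolys Y" "\<And>u m. Poly_Mapping.keys u \<subseteq> Y \<Longrightarrow> u + m \<in> A \<longleftrightarrow> m \<in> A"
  shows "part A Y (f * q) = f * part A Y q"
  using assms(1)
proof (induction f rule: mpolys_induct)
  case (add u c f)
  then show ?case
    using assms(2) by (simp add: distrib_right part_add part_single_mult restr_id)
qed simp

text \<open>The preimage of a fibre of \<phi> under translation by an exponent vector is a fibre or
  empty; cancellation in the monoid of degrees makes it a single fibre.\<close>

lemma part_mult_eq_0:
  fixes \<phi> :: "(nat \<Rightarrow>\<^sub>0 nat) \<Rightarrow> 'g::cancel_comm_monoid_add"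
  assumes "f \<in> mpolys X" "X \<inter> Y = {}" and add: "\<And>m m'. \<phi> (m + m') = \<phi> m + \<phi> m'"
    and zero: "\<And>\<gamma>. part {m. \<phi> m = \<gamma>} {} f = 0"
  shows "part {m. \<phi> m = \<gamma>} Y (q * f) = 0"
  using mpolys_UNIV[of q]
proof (induction q rule: mpolys_induct)
  case (add m c q)
  have "part {u. \<phi> m + \<phi> u = \<gamma>} Y f = 0"
  proof (cases "\<exists>\<gamma>'. \<gamma> = \<phi> m + \<gamma>'")
    case True
    then obtain \<gamma>' where "\<gamma> = \<phi> m + \<gamma>'" by blast
    then have "{u. \<phi> m + \<phi> u = \<gamma>} = {u. \<phi> u = \<gamma>'}" by auto
    then show ?thesis using zero part_disjoint[OF assms(1,2)] by simp
  next
    case False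
    then have "{u. \<phi> m + \<phi> u = \<gamma>} = {}" by auto
    then show ?thesis by simp
  qed
  then show ?case using add by (simp add: distrib_right part_add part_single_mult assms(3))
qed simp

lemma part_part: "part B Z (part A Y p) = part {m \<in> A. restr Y m \<in> B} (Z \<inter> Y) p"
  using mpolys_UNIV[of p]
proof (induction p rule: mpolys_induct)
  case (add m c p)
  then show ?case by (simp add: part_add part_single)
qed simp

section \<open>Toric ideals\<close>

text \<open>With no variable kept, \<open>part\<close> is a constant, the sum of the coefficients in
  degree \<gamma>. So this is the kernel of the linear map that sends a monomial to a basis symbol
  for its degree. Degrees may be weights or whole exponent vectors, hence the free type.\<close>

definition toric :: "((nat \<Rightarrow>\<^sub>0 nat) \<Rightarrow> 'g) \<Rightarrow> nat set \<Rightarrow> cmpoly set" where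
  "toric \<phi> V = {p \<in> mpolys V. \<forall>\<gamma>. part {m. \<phi> m = \<gamma>} {} p = 0}"

lemma binomial_in_toric:
  assumes "Poly_Mapping.keys m \<subseteq> V" "Poly_Mapping.keys m' \<subseteq> V" "\<phi> m = \<phi> m'"
  shows "Poly_Mapping.single m 1 - Poly_Mapping.single m' 1 \<in> toric \<phi> V"
  unfolding toric_def using assms by (auto intro!: mpolys_diff mpolys_single simp: part_diff part_single)

lemma toric_cong: "(\<And>m. Poly_Mapping.keys m \<subseteq> V \<Longrightarrow> \<phi> m = \<psi> m) \<Longrightarrow> toric \<phi> V = toric \<psi> V"
proof -
  assume eq: "\<And>m. Poly_Mapping.keys m \<subseteq> V \<Longrightarrow> \<phi> m = \<psi> m"
  have "part {m. \<phi> m = \<gamma>} {} p = part {m. \<psi> m = \<gamma>} {} p" if "p \<in> mpolys V" for p \<gamma>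
    by (rule part_cong) (use that eq in \<open>auto simp: mpolys_def\<close>)
  then show ?thesis by (auto simp: toric_def)
qed

text \<open>Modulo the binomials, the monomials on \<open>X\<close> of equal degree may be replaced by a common
  representative, so that \<open>p\<close> becomes a combination of its parts.\<close>

lemma in_ideal_of_if_parts:
  assumes disj: "X \<inter> Y = {}" and p: "p \<in> mpolys (X \<union> Y)"
    and bin: "\<And>m m'. Poly_Mapping.keys m \<subseteq> X \<Longrightarrow> Poly_Mapping.keys m' \<subseteq> X \<Longrightarrow> \<phi> m = \<phi> m' \<Longrightarrow>
      Poly_Mapping.single m 1 - Poly_Mapping.single m' 1 \<in> ideal_of (X \<union> Y) F"
    and restr: "\<And>m. Poly_Mapping.keys m \<subseteq> X \<union> Y \<Longrightarrow> \<phi> (restr X m) = \<phi> m"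
    and parts: "\<And>\<gamma>. part {m. \<phi> m = \<gamma>} Y p \<in> ideal_of (X \<union> Y) F"
  shows "p \<in> ideal_of (X \<union> Y) F"
proof -
  define u where "u \<gamma> = (SOME m. Poly_Mapping.keys m \<subseteq> X \<and> \<phi> m = \<gamma>)" for \<gamma>
  have kp: "Poly_Mapping.keys m \<subseteq> X \<union> Y" if "m \<in> Poly_Mapping.keys p" for m using that p by (auto simp: mpolys_def)
  have u: "Poly_Mapping.keys (u (\<phi> m)) \<subseteq> X \<and> \<phi> (u (\<phi> m)) = \<phi> m" if "m \<in> Poly_Mapping.keys p" for m
    unfolding u_def by (rule someI[of _ "restr X m"]) (use restr[OF kp[OF that]] in auto)
  let ?s = "\<lambda>m. Poly_Mapping.single (restr Y m) (Poly_Mapping.lookup p m)"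
  have "Poly_Mapping.single m (Poly_Mapping.lookup p m) = (Poly_Mapping.single (restr X m) 1 - Poly_Mapping.single (u (\<phi> m)) 1) * ?s m + Poly_Mapping.single (u (\<phi> m)) 1 * ?s m"
    if "m \<in> Poly_Mapping.keys p" for m
  proof -
    have "Poly_Mapping.single m (Poly_Mapping.lookup p m) = Poly_Mapping.single (restr X m) 1 * ?s m"
      using restr_split[OF kp[OF that] disj] by (simp add: mult_single)
    then show ?thesis by (simp add: algebra_simps)
  qed
  then have "p = (\<Sum>m\<in>Poly_Mapping.keys p. (Poly_Mapping.single (restr X m) 1 - Poly_Mapping.single (u (\<phi> m)) 1) * ?s m + Poly_Mapping.single (u (\<phi> m)) 1 * ?s m)"
    using poly_mapping_sum_single[of "Poly_Mapping.keys p" p] by simp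
  also have "\<dots> = (\<Sum>m\<in>Poly_Mapping.keys p. ?s m * (Poly_Mapping.single (restr X m) 1 - Poly_Mapping.single (u (\<phi> m)) 1)) + (\<Sum>m\<in>Poly_Mapping.keys p. Poly_Mapping.single (u (\<phi> m)) 1 * ?s m)"
    by (simp add: sum.distrib mult.commute)
  also have "(\<Sum>m\<in>Poly_Mapping.keys p. Poly_Mapping.single (u (\<phi> m)) 1 * ?s m)
      = (\<Sum>\<gamma>\<in>\<phi> ` Poly_Mapping.keys p. Poly_Mapping.single (u \<gamma>) 1 * part {m. \<phi> m = \<gamma>} Y p)"
  proof -
    have "(\<Sum>m\<in>{m \<in> Poly_Mapping.keys p. \<phi> m = \<gamma>}. Poly_Mapping.single (u (\<phi> m)) 1 * ?s m) = Poly_Mapping.single (u \<gamma>) 1 * part {m. \<phi> m = \<gamma>} Y p" for \<gamma>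
      unfolding part_def by (subst sum_distrib_left, rule sum.cong) auto
    then show ?thesis by (simp add: sum.image_gen[of "Poly_Mapping.keys p" _ \<phi>])
  qed
  also have "(\<Sum>m\<in>Poly_Mapping.keys p. ?s m * (Poly_Mapping.single (restr X m) 1 - Poly_Mapping.single (u (\<phi> m)) 1)) + \<dots> \<in> ideal_of (X \<union> Y) F"
  proof (intro ideal_of_add ideal_of_sum ideal_of_mult bin parts)
    fix m assume m: "m \<in> Poly_Mapping.keys p"
    show "Poly_Mapping.keys (u (\<phi> m)) \<subseteq> X" "\<phi> (restr X m) = \<phi> (u (\<phi> m))"
      using u[OF m] restr[OF kp[OF m]] by auto
  next
    fix \<gamma> assume "\<gamma> \<in> \<phi> ` Poly_Mapping.keys p"
    then show "Poly_Mapping.single (u \<gamma>) 1 \<in> mpolys (X \<union> Y)" using u by (auto intro: mpolys_single)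
  qed (auto intro: mpolys_single)
  finally show ?thesis .
qed

text \<open>The quotient by \<open>F\<close> has a one-dimensional piece for each degree of a
  monomial on \<open>X\<close>. Adjoining \<open>Y\<close> turns each piece into a copy of the
  polynomials on \<open>Y\<close>, and membership is tested on every copy separately.\<close>

lemma in_ideal_of_Un_iff:
  fixes \<phi> :: "(nat \<Rightarrow>\<^sub>0 nat) \<Rightarrow> 'g::cancel_comm_monoid_add"
  assumes disj: "X \<inter> Y = {}" and add: "\<And>m m'. \<phi> (m + m') = \<phi> m + \<phi> m'"
    and zero: "\<And>m. Poly_Mapping.keys m \<subseteq> Y \<Longrightarrow> \<phi> m = 0"
    and F: "ideal_of X F = toric \<phi> X" and H: "H \<subseteq> mpolys Y" and p: "p \<in> mpolys (X \<union> Y)"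
  shows "p \<in> ideal_of (X \<union> Y) (F \<union> H) \<longleftrightarrow> (\<forall>\<gamma>. part {m. \<phi> m = \<gamma>} Y p \<in> ideal_of Y H)"
proof
  assume "p \<in> ideal_of (X \<union> Y) (F \<union> H)"
  then show "\<forall>\<gamma>. part {m. \<phi> m = \<gamma>} Y p \<in> ideal_of Y H"
  proof (induction p rule: ideal_of.induct)
    case (step p f q)
    have "part {m. \<phi> m = \<gamma>} Y (q * f) \<in> ideal_of Y H" for \<gamma>
    proof (cases "f \<in> F")
      case True
      then have "f \<in> toric \<phi> X" using F ideal_of_gen by blast
      then have "part {m. \<phi> m = \<gamma>} Y (q * f) = 0"
        using disj add by (intro part_mult_eq_0[of f X]) (auto simp: toric_def)
      then show ?thesis by (simp add: ideal_of.zero)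
    next
      case False
      then have "f \<in> H" using step by blast
      then have "part {m. \<phi> m = \<gamma>} Y (f * q) = f * part {m. \<phi> m = \<gamma>} Y q"
        using H add zero by (intro part_mult) auto
      then show ?thesis
        using ideal_of_mult[OF ideal_of_gen[OF \<open>f \<in> H\<close>] part_in_mpolys] by (simp add: mult.commute)
    qed
    then show ?case using step by (simp add: part_add ideal_of_add)
  qed (simp add: ideal_of.zero)
next
  assume parts: "\<forall>\<gamma>. part {m. \<phi> m = \<gamma>} Y p \<in> ideal_of Y H"
  show "p \<in> ideal_of (X \<union> Y) (F \<union> H)"
  proof (rule in_ideal_of_if_parts[OF disj p, of \<phi>])
    fix m m' :: "nat \<Rightarrow>\<^sub>0 nat" assume "Poly_Mapping.keys m \<subseteq> X" "Poly_Mapping.keys m' \<subseteq> X" "\<phi> m = \<phi> m'"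
    then have "Poly_Mapping.single m 1 - Poly_Mapping.single m' 1 \<in> ideal_of X F" unfolding F by (rule binomial_in_toric)
    then show "Poly_Mapping.single m 1 - Poly_Mapping.single m' 1 \<in> ideal_of (X \<union> Y) (F \<union> H)" using ideal_of_mono by blast
  next
    fix m :: "nat \<Rightarrow>\<^sub>0 nat" assume "Poly_Mapping.keys m \<subseteq> X \<union> Y"
    then have "\<phi> m = \<phi> (restr X m) + \<phi> (restr Y m)" using restr_split disj add by metis
    then show "\<phi> (restr X m) = \<phi> m" using zero[of "restr Y m"] by simp
  next
    fix \<gamma> show "part {m. \<phi> m = \<gamma>} Y p \<in> ideal_of (X \<union> Y) (F \<union> H)"
      using parts ideal_of_mono[of Y "X \<union> Y" H "F \<union> H"] by blast
  qed
qed

text \<open>For \<open>F = {}\<close> the grading is by the exponent vectors on \<open>X\<close>, which have trivial toric ideal.\<close>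

lemma toric_restr: "toric (restr X) X = {0}"
proof -
  have "p = 0" if "p \<in> toric (restr X) X" for p
  proof (rule poly_mapping_eqI)
    fix k
    have p: "p \<in> mpolys X" "part {m. restr X m = k} {} p = 0" using that by (auto simp: toric_def)
    show "Poly_Mapping.lookup p k = Poly_Mapping.lookup 0 k"
    proof (cases "k \<in> Poly_Mapping.keys p")
      case True
      then have "Poly_Mapping.keys p \<inter> {m. restr X m = k} = {k}" using p(1) by (auto simp: mpolys_def restr_id)
      then have "part {m. restr X m = k} {} p = Poly_Mapping.single 0 (Poly_Mapping.lookup p k)" by (simp add: part_def)
      then show ?thesis using p(2) by (metis lookup_single_eq lookup_zero)
    qed (simp add: in_keys_iff)
  qed
  moreover have "0 \<in> toric (restr X) X" by (simp add: toric_def)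
  ultimately show ?thesis by blast
qed

section \<open>Regular elements in a larger polynomial ring\<close>

definition nonzerodivisor :: "nat set \<Rightarrow> cmpoly set \<Rightarrow> cmpoly \<Rightarrow> bool" where
  "nonzerodivisor V F f \<longleftrightarrow> (\<forall>g\<in>mpolys V. f * g \<in> ideal_of V F \<longrightarrow> g \<in> ideal_of V F)"

text \<open>Multiplication by \<open>f\<close>, which involves only \<open>Y\<close>, acts on each
  component separately. This is flatness of the tensor product over a field, in concrete
  form.\<close>

lemma nonzerodivisor_Un:
  fixes \<phi> :: "(nat \<Rightarrow>\<^sub>0 nat) \<Rightarrow> 'g::cancel_comm_monoid_add"
  assumes "X \<inter> Y = {}" "\<And>m m'. \<phi> (m + m') = \<phi> m + \<phi> m'" "\<And>m. Poly_Mapping.keys m \<subseteq> Y \<Longrightarrow> \<phi> m = 0"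
    and "ideal_of X F = toric \<phi> X" "H \<subseteq> mpolys Y" "f \<in> mpolys Y" "nonzerodivisor Y H f"
  shows "nonzerodivisor (X \<union> Y) (F \<union> H) f"
  unfolding nonzerodivisor_def
proof (intro ballI impI)
  fix g assume g: "g \<in> mpolys (X \<union> Y)" "f * g \<in> ideal_of (X \<union> Y) (F \<union> H)"
  have f: "f \<in> mpolys (X \<union> Y)" using assms(6) mpolys_mono by blast
  have iff: "p \<in> ideal_of (X \<union> Y) (F \<union> H) \<longleftrightarrow> (\<forall>\<gamma>. part {m. \<phi> m = \<gamma>} Y p \<in> ideal_of Y H)"
    if "p \<in> mpolys (X \<union> Y)" for p
    by (rule in_ideal_of_Un_iff) (use assms that in auto)
  have "part {m. \<phi> m = \<gamma>} Y (f * g) = f * part {m. \<phi> m = \<gamma>} Y g" for \<gamma>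
    using assms(2,3,6) by (intro part_mult) auto
  then have "f * part {m. \<phi> m = \<gamma>} Y g \<in> ideal_of Y H" for \<gamma>
    using g(2) iff[OF mpolys_mult[OF f g(1)]] by metis
  then have "part {m. \<phi> m = \<gamma>} Y g \<in> ideal_of Y H" for \<gamma>
    using assms(7) part_in_mpolys by (simp add: nonzerodivisor_def)
  then show "g \<in> ideal_of (X \<union> Y) (F \<union> H)" using iff[OF g(1)] by blast
qed

lemma nonzerodivisor_extend:
  assumes "X \<inter> Y = {}" "H \<subseteq> mpolys Y" "f \<in> mpolys Y" "nonzerodivisor Y H f"
  shows "nonzerodivisor (X \<union> Y) H f"
  using nonzerodivisor_Un[of X Y "restr X" "{}" H f] assms
  by (auto simp: toric_restr restr_add intro!: restr_zero)

section \<open>Presentations of semigroup algebras by regular sequences\<close>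

definition wt :: "(nat \<Rightarrow> nat) \<Rightarrow> (nat \<Rightarrow>\<^sub>0 nat) \<Rightarrow> nat" where
  "wt d m = (\<Sum>i\<in>Poly_Mapping.keys m. Poly_Mapping.lookup m i * d i)"

lemma wt_zero [simp]: "wt d 0 = 0"
  by (simp add: wt_def)

lemma wt_add: "wt d (m + m') = wt d m + wt d m'"
  unfolding wt_def by (rule setsum_keys_plus_distrib) (simp_all add: algebra_simps)

lemma wt_of_nat_mult: "wt d (of_nat k * m) = k * wt d m"
  by (induction k) (simp_all add: wt_add distrib_right)

lemma wt_scale: "(\<And>i. i \<in> Poly_Mapping.keys m \<Longrightarrow> d i = b * e i) \<Longrightarrow> wt d m = b * wt e m"
  unfolding wt_def by (simp add: sum_distrib_left algebra_simps)

text \<open>The toric ideal of \<open>wt d\<close> is the kernel of \<open>x\<^sub>i \<mapsto> t\<^bsup>d i\<^esup>\<close>.\<close>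

definition ci_presentation :: "nat set \<Rightarrow> (nat \<Rightarrow> nat) \<Rightarrow> cmpoly list \<Rightarrow> nat set \<Rightarrow> bool" where
  "ci_presentation V d fs \<Gamma> \<longleftrightarrow>
     (\<forall>i\<in>V. d i > 0) \<and> \<Gamma> = wt d ` {m. Poly_Mapping.keys m \<subseteq> V} \<and>
     (\<forall>f\<in>set fs. f \<in> mpolys V \<and> weighted_homogeneous d f) \<and>
     (\<forall>i<length fs. nonzerodivisor V (set (take i fs)) (fs ! i)) \<and>
     ideal_of V (set fs) = toric (wt d) V"

text \<open>A monomial in one variable of weight 1 is determined by its degree, so the weight
  grading is the grading by exponent vectors, whose toric ideal is 0.\<close>

lemma ci_presentation_UNIV: "ci_presentation {i} (\<lambda>_. 1) [] UNIV"
  unfolding ci_presentation_def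
proof (intro conjI)
  have rep: "m = Poly_Mapping.single i (wt (\<lambda>_. 1) m)" if "Poly_Mapping.keys m \<subseteq> {i}" for m
  proof (rule poly_mapping_eqI)
    have "wt (\<lambda>_. 1) m = (\<Sum>i\<in>{i}. Poly_Mapping.lookup m i)"
      unfolding wt_def by (rule sum.mono_neutral_cong_left) (use that in \<open>auto simp: in_keys_iff\<close>)
    then show "Poly_Mapping.lookup m k = Poly_Mapping.lookup (Poly_Mapping.single i (wt (\<lambda>_. 1) m)) k" for k
      using that by (cases "k = i") (auto simp: lookup_single in_keys_iff)
  qed
  have "toric (wt (\<lambda>_. 1)) {i} = toric (restr {i}) {i}"
  proof (intro equalityI subsetI)
    fix p assume "p \<in> toric (wt (\<lambda>_. 1)) {i}"
    then have p: "p \<in> mpolys {i}" "part {m. wt (\<lambda>_. 1) m = k} {} p = 0" for k by (auto simp: toric_def)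
    have "part {m. restr {i} m = u} {} p = 0" for u
    proof (cases "Poly_Mapping.keys u \<subseteq> {i}")
      case True
      have "part {m. restr {i} m = u} {} p = part {m. wt (\<lambda>_. 1) m = wt (\<lambda>_. 1) u} {} p"
      proof (rule part_cong)
        fix m assume "m \<in> Poly_Mapping.keys p"
        then have m: "Poly_Mapping.keys m \<subseteq> {i}" using p(1) by (auto simp: mpolys_def)
        then have "restr {i} m = m" by (rule restr_id)
        then show "m \<in> {m. restr {i} m = u} \<longleftrightarrow> m \<in> {m. wt (\<lambda>_. 1) m = wt (\<lambda>_. 1) u}"
          using rep[OF m] rep[OF True] by auto
      qed
      then show ?thesis using p(2) by simp
    next
      case False
      then have "{m. restr {i} m = u} = {}" by auto
      then show ?thesis by simp
    qed
    then show "p \<in> toric (restr {i}) {i}" using p(1) by (simp add: toric_def)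
  next
    fix p assume "p \<in> toric (restr {i}) {i}"
    then show "p \<in> toric (wt (\<lambda>_. 1)) {i}" by (simp add: toric_restr) (simp add: toric_def)
  qed
  then show "ideal_of {i} (set []) = toric (wt (\<lambda>_. 1)) {i}" by (simp add: toric_restr)
  have "k \<in> wt (\<lambda>_. 1) ` {m. Poly_Mapping.keys m \<subseteq> {i}}" for k
    by (rule image_eqI[of _ _ "Poly_Mapping.single i k"]) (auto simp: wt_def)
  then show "UNIV = wt (\<lambda>_. 1) ` {m. Poly_Mapping.keys m \<subseteq> {i}}" by blast
qed auto

text \<open>Write \<open>c(\<gamma>, \<eta>)\<close> for the coefficients of \<open>g\<close> in the grading by \<open>\<nat>\<^sup>2\<close>. If \<open>(x\<^sup>u - y\<^sup>v) g\<close>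
  vanishes then \<open>c(\<gamma>, \<eta>) = c(\<gamma> + a, \<eta> - b) = c(\<gamma> + 2a, \<eta> - 2b) = \<dots> = 0\<close>.\<close>

lemma bigraded_parts_eq_0:
  fixes \<phi> \<psi> :: "(nat \<Rightarrow>\<^sub>0 nat) \<Rightarrow> nat"
  assumes \<phi>: "\<And>m m'. \<phi> (m + m') = \<phi> m + \<phi> m'" and \<psi>: "\<And>m m'. \<psi> (m + m') = \<psi> m + \<psi> m'"
    and u: "\<phi> u = a" "\<psi> u = 0" and v: "\<phi> v = 0" "\<psi> v = b" "b > 0"
    and zero: "\<And>\<gamma> \<eta>. part {m. \<phi> m = \<gamma> \<and> \<psi> m = \<eta>} {} ((Poly_Mapping.single u 1 - Poly_Mapping.single v 1) * g) = 0"
  shows "part {m. \<phi> m = \<gamma> \<and> \<psi> m = \<eta>} {} g = 0"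
proof (induction \<eta> arbitrary: \<gamma> rule: less_induct)
  case (less \<eta>)
  have "0 = part {m. \<phi> m = \<gamma> + a \<and> \<psi> m = \<eta>} {} ((Poly_Mapping.single u 1 - Poly_Mapping.single v 1) * g)" using zero by simp
  also have "\<dots> = part {m. \<phi> m = \<gamma> \<and> \<psi> m = \<eta>} {} g - part {m. \<phi> m = \<gamma> + a \<and> b + \<psi> m = \<eta>} {} g"
    by (simp add: left_diff_distrib part_diff part_single_mult \<phi> \<psi> u v add.commute)
  also have "part {m. \<phi> m = \<gamma> + a \<and> b + \<psi> m = \<eta>} {} g = 0"
  proof (cases "b \<le> \<eta>")
    case True
    then have "{m. \<phi> m = \<gamma> + a \<and> b + \<psi> m = \<eta>} = {m. \<phi> m = \<gamma> + a \<and> \<psi> m = \<eta> - b}" by auto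
    then show ?thesis using less[of "\<eta> - b"] True v(3) by simp
  next
    case False
    then have "{m. \<phi> m = \<gamma> + a \<and> b + \<psi> m = \<eta>} = {}" by auto
    then show ?thesis by (simp only: part_empty)
  qed
  finally show ?case by simp
qed

section \<open>Presenting a glued semigroup\<close>

locale ci_gluing =
  fixes X Y :: "nat set" and d e fs gs G H a b u v
  assumes pX: "ci_presentation X d fs G" and pY: "ci_presentation Y e gs H" and disj: "X \<inter> Y = {}"
    and cop: "coprime a b" and pos: "a > 0" "b > 0"
    and u: "Poly_Mapping.keys u \<subseteq> X" "wt d u = a" and v: "Poly_Mapping.keys v \<subseteq> Y" "wt e v = b"
begin

definition D where "D i = (if i \<in> X then b * d i else a * e i)"
text \<open>The vectors \<open>u\<close> and \<open>v\<close> witness a \<in> G and b \<in> H. After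
  rescaling, both monomials have weight ab, so \<open>f\<close> is homogeneous.\<close>

definition f where "f = Poly_Mapping.single u 1 - (Poly_Mapping.single v 1 :: cmpoly)"
text \<open>The two unscaled degrees, extended by ignoring the other variables. The terms of
  \<open>f\<close> have bidegrees (a, 0) and (0, b).\<close>

definition \<phi> where "\<phi> m = wt d (restr X m)"
definition \<psi> where "\<psi> m = wt e (restr Y m)"

lemma \<phi>_add: "\<phi> (m + m') = \<phi> m + \<phi> m'" and \<psi>_add: "\<psi> (m + m') = \<psi> m + \<psi> m'"
  by (simp_all add: \<phi>_def \<psi>_def restr_add wt_add)

lemma \<phi>_X: "Poly_Mapping.keys m \<subseteq> X \<Longrightarrow> \<phi> m = wt d m" and \<phi>_Y: "Poly_Mapping.keys m \<subseteq> Y \<Longrightarrow> \<phi> m = 0"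
  and \<psi>_Y: "Poly_Mapping.keys m \<subseteq> Y \<Longrightarrow> \<psi> m = wt e m" and \<psi>_X: "Poly_Mapping.keys m \<subseteq> X \<Longrightarrow> \<psi> m = 0"
  using disj by (auto simp: \<phi>_def \<psi>_def restr_id Int_commute intro!: arg_cong[of _ 0 "wt _", simplified] restr_zero)

lemma wt_X: "Poly_Mapping.keys m \<subseteq> X \<Longrightarrow> wt D m = b * wt d m" and wt_Y: "Poly_Mapping.keys m \<subseteq> Y \<Longrightarrow> wt D m = a * wt e m"
  using disj by (auto intro!: wt_scale simp: D_def disjoint_iff)

lemma wt_D:
  assumes "Poly_Mapping.keys m \<subseteq> X \<union> Y"
  shows "wt D m = b * \<phi> m + a * \<psi> m"
proof -
  have "wt D m = wt D (restr X m) + wt D (restr Y m)"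
    using restr_split[OF assms disj] wt_add by metis
  then show ?thesis using wt_X[of "restr X m"] wt_Y[of "restr Y m"] by (simp add: \<phi>_def \<psi>_def)
qed

lemma fs: "set fs \<subseteq> mpolys X" "ideal_of X (set fs) = toric \<phi> X"
  and gs: "set gs \<subseteq> mpolys Y" "ideal_of Y (set gs) = toric \<psi> Y"
  using pX pY toric_cong[of X \<phi> "wt d"] toric_cong[of Y \<psi> "wt e"] \<phi>_X \<psi>_Y
  by (auto simp: ci_presentation_def)

lemma toric_X: "ideal_of X (set fs) = toric (wt d) X" and toric_Y: "ideal_of Y (set gs) = toric (wt e) Y"
  using pX pY by (auto simp: ci_presentation_def)

lemma f_in: "f \<in> mpolys (X \<union> Y)"
  unfolding f_def using u v by (intro mpolys_diff mpolys_single) auto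

text \<open>Before \<open>f\<close> is imposed, the quotient is a tensor product with a basis
  indexed by bidegrees. Taking \<phi>-parts and then \<psi>-parts of the result yields its
  coordinates.\<close>

lemma in_ideal_fs_gs_iff:
  assumes "p \<in> mpolys (X \<union> Y)"
  shows "p \<in> ideal_of (X \<union> Y) (set fs \<union> set gs) \<longleftrightarrow> (\<forall>\<gamma> \<eta>. part {m. \<phi> m = \<gamma> \<and> \<psi> m = \<eta>} {} p = 0)"
proof -
  have "p \<in> ideal_of (X \<union> Y) (set fs \<union> set gs) \<longleftrightarrow> (\<forall>\<gamma>. part {m. \<phi> m = \<gamma>} Y p \<in> ideal_of Y (set gs))"
    by (rule in_ideal_of_Un_iff) (use disj \<phi>_add \<phi>_Y fs gs assms in auto)
  also have "\<dots> \<longleftrightarrow> (\<forall>\<gamma> \<eta>. part {m. \<psi> m = \<eta>} {} (part {m. \<phi> m = \<gamma>} Y p) = 0)"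
    unfolding gs(2) by (simp add: toric_def part_in_mpolys)
  also have "\<dots> \<longleftrightarrow> (\<forall>\<gamma> \<eta>. part {m. \<phi> m = \<gamma> \<and> \<psi> m = \<eta>} {} p = 0)"
    by (simp add: part_part \<psi>_def)
  finally show ?thesis .
qed

lemma nonzerodivisor_f: "nonzerodivisor (X \<union> Y) (set fs \<union> set gs) f"
  unfolding nonzerodivisor_def
proof (intro ballI impI)
  fix g assume g: "g \<in> mpolys (X \<union> Y)" "f * g \<in> ideal_of (X \<union> Y) (set fs \<union> set gs)"
  have "part {m. \<phi> m = \<gamma> \<and> \<psi> m = \<eta>} {} g = 0" for \<gamma> \<eta>
  proof (rule bigraded_parts_eq_0[of \<phi> \<psi> u a v b])
    show "part {m. \<phi> m = \<gamma> \<and> \<psi> m = \<eta>} {} ((Poly_Mapping.single u 1 - Poly_Mapping.single v 1) * g) = 0" for \<gamma> \<eta>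
      using g in_ideal_fs_gs_iff[OF mpolys_mult[OF f_in g(1)]] by (simp add: f_def)
  qed (use u v pos \<phi>_add \<psi>_add \<phi>_X \<phi>_Y \<psi>_X \<psi>_Y in auto)
  then show "g \<in> ideal_of (X \<union> Y) (set fs \<union> set gs)" using in_ideal_fs_gs_iff g(1) by blast
qed

text \<open>Rescaling weights by c > 0 only relabels fibres: degree k comes from k / c, or from
  nothing if c does not divide k. So the old generators stay in the kernel, and \<open>f\<close>
  joins them because its two monomials have equal weight.\<close>

lemma ideal_subset_toric: "ideal_of (X \<union> Y) (set fs \<union> set gs \<union> {f}) \<subseteq> toric (wt D) (X \<union> Y)"
proof
  have gen: "f' \<in> mpolys (X \<union> Y)" "part {m. wt D m = k} {} f' = 0"
    if f': "f' \<in> set fs \<union> set gs \<union> {f}" for f' k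
  proof -
    have scale: "part {m. wt D m = k} {} f' = 0"
      if "f' \<in> toric (wt w) W" "c > 0" "\<And>m. Poly_Mapping.keys m \<subseteq> W \<Longrightarrow> wt D m = c * wt w m" for w W c
    proof -
      have "part {m. wt D m = k} {} f' = part {m. c * wt w m = k} {} f'"
        by (rule part_cong) (use that in \<open>auto simp: toric_def mpolys_def\<close>)
      also have "\<dots> = 0"
      proof (cases "c dvd k")
        case True
        then have "{m. c * wt w m = k} = {m. wt w m = k div c}" using that(2) by auto
        then show ?thesis using that(1) by (simp add: toric_def)
      next
        case False
        then have "{m. c * wt w m = k} = {}" by auto
        then show ?thesis by simp
      qed
      finally show ?thesis .
    qed
    have mono: "mpolys X \<subseteq> mpolys (X \<union> Y)" "mpolys Y \<subseteq> mpolys (X \<union> Y)" by (auto intro!: mpolys_mono)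
    consider "f' \<in> set fs" | "f' \<in> set gs" | "f' = f" using f' by blast
    then have "f' \<in> mpolys (X \<union> Y) \<and> part {m. wt D m = k} {} f' = 0"
    proof cases
      case 1
      then have "f' \<in> toric (wt d) X" unfolding toric_X[symmetric] by (rule ideal_of_gen)
      then show ?thesis using scale[of d X b] pos wt_X mono by (auto simp: toric_def)
    next
      case 2
      then have "f' \<in> toric (wt e) Y" unfolding toric_Y[symmetric] by (rule ideal_of_gen)
      then show ?thesis using scale[of e Y a] pos wt_Y mono by (auto simp: toric_def)
    next
      case 3
      have "wt D u = wt D v" using u v wt_X wt_Y by simp
      then show ?thesis using f_in 3 by (auto simp: f_def part_diff part_single)
    qed
    then show "f' \<in> mpolys (X \<union> Y)" "part {m. wt D m = k} {} f' = 0" by auto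
  qed
  fix p assume "p \<in> ideal_of (X \<union> Y) (set fs \<union> set gs \<union> {f})"
  then show "p \<in> toric (wt D) (X \<union> Y)"
  proof (induction p rule: ideal_of.induct)
    case (step p f' q)
    have "part {m. wt D m = k} {} (q * f') = 0" for k
      using gen[OF step(2)] by (intro part_mult_eq_0[of f' "X \<union> Y"]) (auto simp: wt_add)
    then show ?case using step gen(1)[OF step(2)]
      by (auto simp: toric_def part_add intro: mpolys_add mpolys_mult)
  qed (simp add: toric_def)
qed

abbreviation "J \<equiv> ideal_of (X \<union> Y) (set fs \<union> set gs \<union> {f})"

text \<open>Toric ideals are spanned by binomials, so the reverse inclusion reduces to comparing
  monomials of equal weight modulo \<open>J\<close>.\<close>

definition cong_mod (infix \<open>\<approx>\<close> 50) where
  "m \<approx> m' \<longleftrightarrow> Poly_Mapping.single m 1 - (Poly_Mapping.single m' 1 :: cmpoly) \<in> J"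

lemma cong_refl: "m \<approx> m"
  by (simp add: cong_mod_def ideal_of.zero)

lemma cong_sym: "m \<approx> m' \<Longrightarrow> m' \<approx> m"
  unfolding cong_mod_def using ideal_of_uminus by fastforce

lemma cong_trans [trans]: "m \<approx> m' \<Longrightarrow> m' \<approx> m'' \<Longrightarrow> m \<approx> m''"
  unfolding cong_mod_def using ideal_of_add by fastforce

lemma cong_add_left: "m \<approx> m' \<Longrightarrow> Poly_Mapping.keys w \<subseteq> X \<union> Y \<Longrightarrow> w + m \<approx> w + m'"
  unfolding cong_mod_def
  using ideal_of_mult[of "Poly_Mapping.single m 1 - Poly_Mapping.single m' 1" "X \<union> Y" "set fs \<union> set gs \<union> {f}" "Poly_Mapping.single w 1"]
  by (simp add: right_diff_distrib mult_single mpolys_single)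

lemma cong_add_right: "m \<approx> m' \<Longrightarrow> Poly_Mapping.keys w \<subseteq> X \<union> Y \<Longrightarrow> m + w \<approx> m' + w"
  using cong_add_left by (simp add: add.commute)

lemma cong_X: "Poly_Mapping.keys m \<subseteq> X \<Longrightarrow> Poly_Mapping.keys m' \<subseteq> X \<Longrightarrow> wt d m = wt d m' \<Longrightarrow> m \<approx> m'"
proof -
  assume "Poly_Mapping.keys m \<subseteq> X" "Poly_Mapping.keys m' \<subseteq> X" "wt d m = wt d m'"
  then have "Poly_Mapping.single m 1 - Poly_Mapping.single m' 1 \<in> ideal_of X (set fs)"
    unfolding toric_X by (rule binomial_in_toric)
  moreover have "ideal_of X (set fs) \<subseteq> J" by (rule ideal_of_mono) auto
  ultimately show ?thesis by (auto simp: cong_mod_def)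
qed

lemma cong_Y: "Poly_Mapping.keys m \<subseteq> Y \<Longrightarrow> Poly_Mapping.keys m' \<subseteq> Y \<Longrightarrow> wt e m = wt e m' \<Longrightarrow> m \<approx> m'"
proof -
  assume "Poly_Mapping.keys m \<subseteq> Y" "Poly_Mapping.keys m' \<subseteq> Y" "wt e m = wt e m'"
  then have "Poly_Mapping.single m 1 - Poly_Mapping.single m' 1 \<in> ideal_of Y (set gs)"
    unfolding toric_Y by (rule binomial_in_toric)
  moreover have "ideal_of Y (set gs) \<subseteq> J" by (rule ideal_of_mono) auto
  ultimately show ?thesis by (auto simp: cong_mod_def)
qed

lemma keys_mult_subset: "Poly_Mapping.keys m \<subseteq> W \<Longrightarrow> Poly_Mapping.keys (of_nat k * m :: nat \<Rightarrow>\<^sub>0 nat) \<subseteq> W"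
  by (induction k) (auto simp: keys_plus_nat distrib_right)

lemma cong_mult: "(of_nat k * u) \<approx> (of_nat k * v)"
proof (induction k)
  case (Suc k)
  have uv: "u \<approx> v" unfolding cong_mod_def by (rule ideal_of_gen) (simp add: f_def)
  have "(of_nat (Suc k) * u) = (of_nat k * u) + u" by (simp add: distrib_right add.commute)
  also have "\<dots> \<approx> (of_nat k * v) + u" using Suc u by (intro cong_add_right) auto
  also have "\<dots> \<approx> (of_nat k * v) + v" using uv v keys_mult_subset[of v Y] by (intro cong_add_left) auto
  also have "\<dots> = (of_nat (Suc k) * v)" by (simp add: distrib_right add.commute)
  finally show ?case .
qed (simp add: cong_refl)

text \<open>Equal values of b\<phi> + a\<psi> with a, b coprime mean that the bidegrees differ by
  k(a, -b). So the X-part of m may be replaced by that of m' times the k-th power of x^u;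
  \<open>f\<close> exchanges this power for the k-th power of y^v, which is absorbed on Y.\<close>

lemma cong_if_wt_eq_aux:
  assumes m: "Poly_Mapping.keys m \<subseteq> X \<union> Y" and m': "Poly_Mapping.keys m' \<subseteq> X \<union> Y" and eq: "wt D m = wt D m'" and ge: "\<phi> m' \<le> \<phi> m"
  shows "m \<approx> m'"
proof -
  have eq2: "b * \<phi> m + a * \<psi> m = b * \<phi> m' + a * \<psi> m'" using eq wt_D m m' by simp
  then have "b * (\<phi> m - \<phi> m') = a * \<psi> m' - a * \<psi> m" using ge by (simp add: diff_mult_distrib2)
  then have "b * (\<phi> m - \<phi> m') = a * (\<psi> m' - \<psi> m)" by (simp add: diff_mult_distrib2)
  then have "a dvd b * (\<phi> m - \<phi> m')" by simp
  then have "a dvd \<phi> m - \<phi> m'" using cop by (simp add: coprime_dvd_mult_right_iff)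
  then obtain k where k: "\<phi> m - \<phi> m' = a * k" by blast
  then have 1: "\<phi> m = \<phi> m' + k * a" using ge by (metis le_add_diff_inverse mult.commute)
  have "a * (\<psi> m + b * k) = a * \<psi> m'" using eq2 unfolding 1 by (simp add: algebra_simps)
  then have 2: "\<psi> m' = \<psi> m + k * b" using pos by (simp add: mult.commute)
  let ?ku = "of_nat k * u" and ?kv = "of_nat k * v"
  have keys_k: "Poly_Mapping.keys ?ku \<subseteq> X" "Poly_Mapping.keys ?kv \<subseteq> Y" using u v keys_mult_subset by auto
  have "m = restr X m + restr Y m" by (rule restr_split[OF m disj])
  also have "\<dots> \<approx> (restr X m' + ?ku) + restr Y m"
  proof (intro cong_add_right cong_X)
    show "wt d (restr X m) = wt d (restr X m' + ?ku)"
      using 1 u by (simp add: wt_add wt_of_nat_mult \<phi>_def)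
  qed (use keys_k in \<open>auto simp: keys_plus_nat\<close>)
  also have "\<dots> = restr X m' + (?ku + restr Y m)" by (simp add: add.assoc)
  also have "\<dots> \<approx> restr X m' + (?kv + restr Y m)"
    by (intro cong_add_left cong_add_right cong_mult) auto
  also have "\<dots> \<approx> restr X m' + restr Y m'"
  proof (intro cong_add_left cong_Y)
    show "wt e (?kv + restr Y m) = wt e (restr Y m')"
      using 2 v by (simp add: wt_add wt_of_nat_mult \<psi>_def)
  qed (use keys_k in \<open>auto simp: keys_plus_nat\<close>)
  also have "\<dots> = m'" by (rule restr_split[OF m' disj, symmetric])
  finally show ?thesis .
qed

lemma cong_if_wt_eq:
  assumes "Poly_Mapping.keys m \<subseteq> X \<union> Y" "Poly_Mapping.keys m' \<subseteq> X \<union> Y" "wt D m = wt D m'"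
  shows "m \<approx> m'"
  using cong_if_wt_eq_aux[of m m'] cong_if_wt_eq_aux[of m' m] assms cong_sym by (metis nat_le_linear)

lemma ideal_eq_toric: "J = toric (wt D) (X \<union> Y)"
proof (intro equalityI subsetI)
  show "p \<in> toric (wt D) (X \<union> Y)" if "p \<in> J" for p using that ideal_subset_toric by blast
  fix p assume p: "p \<in> toric (wt D) (X \<union> Y)"
  \<comment> \<open>The criterion is used with all variables in the graded role and none left over,
    so the parts are constants, and they vanish.\<close>
  have "p \<in> ideal_of (X \<union> Y \<union> {}) (set fs \<union> set gs \<union> {f})"
  proof (rule in_ideal_of_if_parts[of _ _ _ "wt D"])
    show "Poly_Mapping.single m 1 - Poly_Mapping.single m' 1 \<in> ideal_of (X \<union> Y \<union> {}) (set fs \<union> set gs \<union> {f})"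
      if "Poly_Mapping.keys m \<subseteq> X \<union> Y" "Poly_Mapping.keys m' \<subseteq> X \<union> Y" "wt D m = wt D m'" for m m'
      using cong_if_wt_eq[OF that] by (simp add: cong_mod_def)
    show "part {m. wt D m = k} {} p \<in> ideal_of (X \<union> Y \<union> {}) (set fs \<union> set gs \<union> {f})" for k
      using p ideal_of.zero by (auto simp: toric_def)
  qed (use p in \<open>auto simp: toric_def restr_id\<close>)
  then show "p \<in> J" by simp
qed

text \<open>Regularity has a different reason in each block: for \<open>fs\<close>, the variables in
  \<open>Y\<close> are free; for \<open>gs\<close>, the quotient by \<open>fs\<close> is graded with
  pieces of dimension at most one; for \<open>f\<close>, the bigrading applies.\<close>

lemma ci_presentation_glue: "ci_presentation (X \<union> Y) D (fs @ gs @ [f]) (glue a b G H)"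
  unfolding ci_presentation_def
proof (intro conjI ballI allI impI)
  show "D i > 0" if "i \<in> X \<union> Y" for i
    using that pX pY pos by (auto simp: D_def ci_presentation_def)
  show "glue a b G H = wt D ` {m. Poly_Mapping.keys m \<subseteq> X \<union> Y}"
  proof (intro equalityI subsetI)
    fix k assume "k \<in> glue a b G H"
    then obtain m m' where m: "k = b * wt d m + a * wt e m'" "Poly_Mapping.keys m \<subseteq> X" "Poly_Mapping.keys m' \<subseteq> Y"
      using pX pY by (auto simp: glue_def ci_presentation_def)
    then have "k = wt D (m + m')" by (simp add: wt_add wt_X wt_Y)
    moreover have "Poly_Mapping.keys (m + m') \<subseteq> X \<union> Y" using m by (auto simp: keys_plus_nat)
    ultimately show "k \<in> wt D ` {m. Poly_Mapping.keys m \<subseteq> X \<union> Y}" by blast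
  next
    fix k assume "k \<in> wt D ` {m. Poly_Mapping.keys m \<subseteq> X \<union> Y}"
    then obtain m where m: "Poly_Mapping.keys m \<subseteq> X \<union> Y" "k = b * \<phi> m + a * \<psi> m" using wt_D by auto
    moreover have "\<phi> m \<in> G" "\<psi> m \<in> H" using pX pY by (auto simp: \<phi>_def \<psi>_def ci_presentation_def)
    ultimately show "k \<in> glue a b G H" by (auto simp: glue_def)
  qed
  have homog: "weighted_homogeneous D h"
    if "weighted_homogeneous w h" "h \<in> mpolys W" "\<And>m. Poly_Mapping.keys m \<subseteq> W \<Longrightarrow> wt D m = c * wt w m" for h w W c
    using that unfolding weighted_homogeneous_def wt_def[symmetric] by (fastforce simp: mpolys_def)
  have "weighted_homogeneous D f"
    unfolding weighted_homogeneous_def wt_def[symmetric]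
  proof (intro exI ballI)
    fix m assume "m \<in> Poly_Mapping.keys f"
    then have "m = u \<or> m = v" unfolding f_def using keys_diff by fastforce
    then show "wt D m = a * b" using u v wt_X wt_Y by auto
  qed
  then show "weighted_homogeneous D h" if "h \<in> set (fs @ gs @ [f])" for h
    using that homog[of d h X b] homog[of e h Y a] wt_X wt_Y pX pY by (auto simp: ci_presentation_def)
  show "h \<in> mpolys (X \<union> Y)" if "h \<in> set (fs @ gs @ [f])" for h
    using that f_in fs(1) gs(1) mpolys_mono[of X "X \<union> Y"] mpolys_mono[of Y "X \<union> Y"] by auto
  show "ideal_of (X \<union> Y) (set (fs @ gs @ [f])) = toric (wt D) (X \<union> Y)"
    using ideal_eq_toric by (simp add: Un_assoc)
  fix i assume i: "i < length (fs @ gs @ [f])"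
  consider "i < length fs" | j where "i = length fs + j" "j < length gs" | "i = length fs + length gs"
    using i by (cases "i < length fs"; cases "i < length fs + length gs") (auto, metis add_diff_inverse_nat nat_add_left_cancel_less)
  then show "nonzerodivisor (X \<union> Y) (set (take i (fs @ gs @ [f]))) ((fs @ gs @ [f]) ! i)"
  proof cases
    case 1
    have "set (take i fs) \<subseteq> mpolys X" "fs ! i \<in> mpolys X"
      using fs(1) 1 set_take_subset[of i fs] nth_mem[OF 1] by auto
    then have "nonzerodivisor (Y \<union> X) (set (take i fs)) (fs ! i)"
      using disj pX 1 by (intro nonzerodivisor_extend) (auto simp: ci_presentation_def)
    then show ?thesis using 1 by (simp add: nth_append Un_commute)
  next
    case 2
    have "set (take j gs) \<subseteq> mpolys Y" "gs ! j \<in> mpolys Y"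
      using gs(1) 2 set_take_subset[of j gs] nth_mem[OF 2(2)] by auto
    then have "nonzerodivisor (X \<union> Y) (set fs \<union> set (take j gs)) (gs ! j)"
      using disj pY 2 \<phi>_add \<phi>_Y fs(2)
      by (intro nonzerodivisor_Un[of X Y \<phi>]) (auto simp: ci_presentation_def)
    then show ?thesis using 2 by (simp add: nth_append)
  next
    case 3
    then show ?thesis using nonzerodivisor_f by (simp add: nth_append)
  qed
qed

end

text \<open>The starting point \<open>N\<close> is arbitrary, so that two presentations can be given disjoint variables.\<close>

definition has_ci_presentation :: "nat set \<Rightarrow> bool" where
  "has_ci_presentation \<Gamma> \<longleftrightarrow> (\<forall>N. \<exists>M\<ge>N. \<exists>d fs. ci_presentation {N..<M} d fs \<Gamma>)"

lemma has_ci_presentation_UNIV: "has_ci_presentation UNIV"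
  unfolding has_ci_presentation_def
proof
  fix N
  have "{N..<Suc N} = {N}" by auto
  then show "\<exists>M\<ge>N. \<exists>d fs. ci_presentation {N..<M} d fs UNIV"
    using ci_presentation_UNIV[of N] by (intro exI[of _ "Suc N"]) auto
qed

lemma has_ci_presentation_glue:
  assumes "coprime a b" "a > 0" "b > 0" "a \<in> G" "b \<in> H" "has_ci_presentation G" "has_ci_presentation H"
  shows "has_ci_presentation (glue a b G H)"
  unfolding has_ci_presentation_def
proof
  fix N
  obtain M d fs where 1: "N \<le> M" "ci_presentation {N..<M} d fs G"
    using assms(6) unfolding has_ci_presentation_def by blast
  obtain K e gs where 2: "M \<le> K" "ci_presentation {M..<K} e gs H"
    using assms(7) unfolding has_ci_presentation_def by blast
  obtain u where u: "Poly_Mapping.keys u \<subseteq> {N..<M}" "wt d u = a" using 1(2) assms(4) by (auto simp: ci_presentation_def)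
  obtain v where v: "Poly_Mapping.keys v \<subseteq> {M..<K}" "wt e v = b" using 2(2) assms(5) by (auto simp: ci_presentation_def)
  interpret ci_gluing "{N..<M}" "{M..<K}" d e fs gs G H a b u v
    by unfold_locales (use 1 2 u v assms in auto)
  have "{N..<M} \<union> {M..<K} = {N..<K}" using 1 2 by auto
  then show "\<exists>M\<ge>N. \<exists>d fs. ci_presentation {N..<M} d fs (glue a b G H)"
    using ci_presentation_glue 1 2 by (intro exI[of _ K]) auto
qed

section \<open>Graded complete intersections\<close>

lemma carrier_mpoly_ring: "carrier (mpoly_ring n) = mpolys {..<n}"
  by (simp add: mpoly_ring_def mpolys_def)

lemma mpoly_ring_ops:
  "x \<otimes>\<^bsub>mpoly_ring n\<^esub> y = x * y" "x \<oplus>\<^bsub>mpoly_ring n\<^esub> y = x + y"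
  "\<one>\<^bsub>mpoly_ring n\<^esub> = 1" "\<zero>\<^bsub>mpoly_ring n\<^esub> = 0"
  by (simp_all add: mpoly_ring_def)

lemma cring_mpoly_ring: "cring (mpoly_ring n)"
proof (rule cringI)
  show "abelian_group (mpoly_ring n)"
  proof (rule abelian_groupI, unfold carrier_mpoly_ring mpoly_ring_ops)
    show "\<exists>y\<in>mpolys {..<n}. y + x = 0" if "x \<in> mpolys {..<n}" for x
      using mpolys_uminus[OF that] by (intro bexI[of _ "- x"]) simp_all
  qed (simp_all add: mpolys_add add.assoc add.commute)
  show "Group.comm_monoid (mpoly_ring n)"
    by (rule comm_monoidI, unfold carrier_mpoly_ring mpoly_ring_ops) (simp_all add: mpolys_mult mult.assoc mult.commute)
qed (simp add: mpoly_ring_ops distrib_right)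

lemma genideal_eq:
  assumes F: "F \<subseteq> mpolys {..<n}"
  shows "Idl\<^bsub>mpoly_ring n\<^esub> F = ideal_of {..<n} F"
proof
  interpret cring "mpoly_ring n" by (rule cring_mpoly_ring)
  have "ideal (ideal_of {..<n} F) (mpoly_ring n)"
  proof (rule idealI)
    show "subgroup (ideal_of {..<n} F) (add_monoid (mpoly_ring n))"
    proof (rule add.subgroupI)
      show "ideal_of {..<n} F \<subseteq> carrier (mpoly_ring n)"
        using ideal_of_subset[OF F] by (simp add: carrier_mpoly_ring)
      show "ideal_of {..<n} F \<noteq> {}" using ideal_of.zero by blast
      fix p assume p: "p \<in> ideal_of {..<n} F"
      have "\<ominus>\<^bsub>mpoly_ring n\<^esub> p = - p"
        using p ideal_of_subset[OF F]
        by (intro minus_equality) (auto simp: carrier_mpoly_ring mpoly_ring_ops intro: mpolys_uminus)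
      then show "\<ominus>\<^bsub>mpoly_ring n\<^esub> p \<in> ideal_of {..<n} F" using p ideal_of_uminus by metis
    qed (simp add: mpoly_ring_ops ideal_of_add)
    show "x \<otimes>\<^bsub>mpoly_ring n\<^esub> p \<in> ideal_of {..<n} F" "p \<otimes>\<^bsub>mpoly_ring n\<^esub> x \<in> ideal_of {..<n} F"
      if "p \<in> ideal_of {..<n} F" "x \<in> carrier (mpoly_ring n)" for p x
      using ideal_of_mult[of p _ F x] that by (simp_all add: carrier_mpoly_ring mpoly_ring_ops mult.commute[of p x])
  qed (rule ring_axioms)
  then show "Idl\<^bsub>mpoly_ring n\<^esub> F \<subseteq> ideal_of {..<n} F"
    by (rule genideal_minimal) (auto intro: ideal_of_gen)
  interpret I: ideal "Idl\<^bsub>mpoly_ring n\<^esub> F" "mpoly_ring n"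
    by (rule genideal_ideal) (simp add: F carrier_mpoly_ring)
  show "ideal_of {..<n} F \<subseteq> Idl\<^bsub>mpoly_ring n\<^esub> F"
  proof
    fix p assume "p \<in> ideal_of {..<n} F"
    then show "p \<in> Idl\<^bsub>mpoly_ring n\<^esub> F"
    proof (induction p rule: ideal_of.induct)
      case zero
      then show ?case using I.zero_closed by (simp add: mpoly_ring_ops)
    next
      case (step p f q)
      have "f \<in> Idl\<^bsub>mpoly_ring n\<^esub> F"
        using genideal_self[of F] F step(2) by (auto simp: carrier_mpoly_ring)
      then have "q \<otimes>\<^bsub>mpoly_ring n\<^esub> f \<oplus>\<^bsub>mpoly_ring n\<^esub> p \<in> Idl\<^bsub>mpoly_ring n\<^esub> F"
        using step by (intro I.a_closed I.I_l_closed) (auto simp: carrier_mpoly_ring)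
      then show ?case by (simp add: mpoly_ring_ops)
    qed
  qed
qed

lemma mpoly_eval_monom: "mpoly_eval (\<lambda>i. monom 1 (d i)) p = (\<Sum>m\<in>Poly_Mapping.keys p. monom (Poly_Mapping.lookup p m) (wt d m))"
proof -
  have "(\<Prod>i\<in>A. monom (1::complex) (d i) ^ Poly_Mapping.lookup m i) = monom 1 (\<Sum>i\<in>A. Poly_Mapping.lookup m i * d i)" for A m
    by (induction A rule: infinite_finite_induct) (auto simp: monom_power mult_monom algebra_simps)
  then show ?thesis by (simp add: mpoly_eval_def wt_def smult_monom)
qed

lemma coeff_mpoly_eval_monom:
  "coeff (mpoly_eval (\<lambda>i. monom 1 (d i)) p) k = (\<Sum>m\<in>Poly_Mapping.keys p \<inter> {m. wt d m = k}. Poly_Mapping.lookup p m)"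
  unfolding mpoly_eval_monom coeff_sum coeff_monom by (simp add: sum.inter_restrict)

lemma single_0_eq_iff: "Poly_Mapping.single (0 :: nat \<Rightarrow>\<^sub>0 nat) (c :: complex) = Poly_Mapping.single 0 c' \<longleftrightarrow> c = c'"
  by (metis lookup_single_eq)

text \<open>Setting all variables to 1 in the part of weight k gives the coefficient of t^k in the
  image. This translates the toric ideal into the kernel of evaluation.\<close>

lemma part_eq_coeff:
  "part {m. wt d m = k} {} p = Poly_Mapping.single 0 (coeff (mpoly_eval (\<lambda>i. monom 1 (d i)) p) k)"
proof -
  have "(\<Sum>m\<in>A. Poly_Mapping.single (0 :: nat \<Rightarrow>\<^sub>0 nat) (c m :: complex)) = Poly_Mapping.single 0 (sum c A)" for A :: "(nat \<Rightarrow>\<^sub>0 nat) set" and c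
    by (induction A rule: infinite_finite_induct) (auto simp: single_add)
  then show ?thesis by (simp add: part_def coeff_mpoly_eval_monom)
qed

lemma mpoly_eval_eq_0_iff:
  "mpoly_eval (\<lambda>i. monom 1 (d i)) p = 0 \<longleftrightarrow> (\<forall>k. part {m. wt d m = k} {} p = 0)"
  using single_0_eq_iff[of _ 0] by (simp add: part_eq_coeff poly_eq_iff)

lemma semigroup_algebra_eq:
  assumes "add_submonoid \<Gamma>"
  shows "semigroup_algebra \<Gamma> = {q. \<forall>k. coeff q k \<noteq> 0 \<longrightarrow> k \<in> \<Gamma>}" (is "_ = ?A")
proof
  have "poly_subalgebra ?A"
    unfolding poly_subalgebra_def
  proof (intro conjI ballI allI)
    show "1 \<in> ?A" using assms by (auto simp: add_submonoid_def)
    fix p q assume pq: "p \<in> ?A" "q \<in> ?A"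
    then show "p + q \<in> ?A" by (auto, metis add.right_neutral)
    have "k \<in> \<Gamma>" if "coeff (p * q) k \<noteq> 0" for k
    proof -
      have "(\<Sum>i\<le>k. coeff p i * coeff q (k - i)) \<noteq> 0" using that by (simp add: coeff_mult)
      then obtain i where "i \<le> k" "coeff p i * coeff q (k - i) \<noteq> 0"
        by (metis (no_types, lifting) atMost_iff sum.neutral)
      then have "i \<in> \<Gamma>" "k - i \<in> \<Gamma>" "i + (k - i) = k" using pq by auto
      then show ?thesis using assms unfolding add_submonoid_def by metis
    qed
    then show "p * q \<in> ?A" by blast
  qed auto
  then show "semigroup_algebra \<Gamma> \<subseteq> ?A"
    unfolding semigroup_algebra_def by (intro hull_minimal) (auto split: if_splits)
  have "?A \<subseteq> B" if B: "poly_subalgebra B" "(\<lambda>\<gamma>. monom 1 \<gamma>) ` \<Gamma> \<subseteq> B" for B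
  proof
    fix q assume q: "q \<in> ?A"
    have zero: "0 \<in> B" using B(1) by (metis poly_subalgebra_def smult_0_left)
    have "(\<Sum>i\<in>A. monom (coeff q i) i) \<in> B" if "finite A" for A
      using that
    proof (induction A rule: finite_induct)
      case (insert i A)
      have "monom (coeff q i) i \<in> B"
      proof (cases "coeff q i = 0")
        case False
        then have "monom 1 i \<in> B" using q B(2) by blast
        then have "smult (coeff q i) (monom 1 i) \<in> B" using B(1) unfolding poly_subalgebra_def by blast
        then show ?thesis by (simp add: smult_monom)
      qed (simp add: zero)
      then show ?case using insert B(1) by (simp add: poly_subalgebra_def)
    qed (simp add: zero)
    from this[of "{..degree q}"] show "q \<in> B" by (simp add: poly_as_sum_of_monoms)
  qed
  then show "?A \<subseteq> semigroup_algebra \<Gamma>" unfolding semigroup_algebra_def hull_def by blast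
qed

lemma ci_semigroup_if_presentation:
  assumes num: "numeric_semigroup \<Gamma>" and "has_ci_presentation \<Gamma>"
  shows "ci_semigroup \<Gamma>"
proof -
  obtain n d fs where "ci_presentation {0..<n} d fs \<Gamma>"
    using assms(2) unfolding has_ci_presentation_def by blast
  then have pres: "ci_presentation {..<n} d fs \<Gamma>" by (simp add: lessThan_atLeast0)
  let ?y = "\<lambda>i. monom (1::complex) (d i)" and ?V = "{..<n}"
  have fs: "set fs \<subseteq> mpolys ?V" using pres by (auto simp: ci_presentation_def)
  have take: "set (take i fs) \<subseteq> mpolys ?V" for i using fs set_take_subset by (rule order_trans[rotated])
  have toric: "ideal_of ?V (set fs) = toric (wt d) ?V" using pres by (simp add: ci_presentation_def)
  have "mpoly_eval ?y ` mpolys ?V = {q. \<forall>k. coeff q k \<noteq> 0 \<longrightarrow> k \<in> \<Gamma>}"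
  proof (intro equalityI subsetI)
    fix q assume "q \<in> mpoly_eval ?y ` mpolys ?V"
    then obtain p where p: "p \<in> mpolys ?V" "q = mpoly_eval ?y p" by blast
    have "k \<in> \<Gamma>" if "coeff q k \<noteq> 0" for k
    proof -
      have "Poly_Mapping.keys p \<inter> {m. wt d m = k} \<noteq> {}"
        using that unfolding p(2) coeff_mpoly_eval_monom by (metis sum.empty)
      then obtain m where "m \<in> Poly_Mapping.keys p" "wt d m = k" by blast
      then show ?thesis using p(1) pres by (auto simp: ci_presentation_def mpolys_def)
    qed
    then show "q \<in> {q. \<forall>k. coeff q k \<noteq> 0 \<longrightarrow> k \<in> \<Gamma>}" by blast
  next
    fix q :: "complex poly" assume q: "q \<in> {q. \<forall>k. coeff q k \<noteq> 0 \<longrightarrow> k \<in> \<Gamma>}"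
    \<comment> \<open>A chosen monomial of weight k; it exists for k in \<Gamma> because \<Gamma> is
      the set of weights of monomials.\<close>
    define m where "m k = (SOME m. Poly_Mapping.keys m \<subseteq> ?V \<and> wt d m = k)" for k
    have m: "Poly_Mapping.keys (m k) \<subseteq> ?V" "wt d (m k) = k" if "k \<in> \<Gamma>" for k
      using someI_ex[of "\<lambda>m. Poly_Mapping.keys m \<subseteq> ?V \<and> wt d m = k"] that pres
      by (auto simp: m_def ci_presentation_def)
    let ?K = "{k. coeff q k \<noteq> 0}"
    have fin: "finite ?K" using MOST_coeff_eq_0[of q] by (simp add: eventually_cofinite)
    define p where "p = (\<Sum>k\<in>?K. Poly_Mapping.single (m k) (coeff q k))"
    have K: "k \<in> \<Gamma>" if "k \<in> ?K" for k using q that by blast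
    have "p \<in> mpolys ?V" unfolding p_def using m K by (intro mpolys_sum mpolys_single) auto
    moreover have "part {m. wt d m = k} {} p = Poly_Mapping.single 0 (coeff q k)" for k
    proof -
      have "part {m. wt d m = k} {} p = (\<Sum>j\<in>?K. if j = k then Poly_Mapping.single 0 (coeff q j) else 0)"
        unfolding p_def part_sum using m(2) K by (intro sum.cong) (auto simp: part_single)
      also have "\<dots> = Poly_Mapping.single 0 (coeff q k)" using fin by simp
      finally show ?thesis .
    qed
    then have "mpoly_eval ?y p = q"
      unfolding part_eq_coeff single_0_eq_iff by (simp add: poly_eq_iff)
    ultimately show "q \<in> mpoly_eval ?y ` mpolys ?V" by blast
  qed
  then have image: "mpoly_eval ?y ` mpolys ?V = semigroup_algebra \<Gamma>"
    using semigroup_algebra_eq num by (simp add: numeric_semigroup_def)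
  have "regular_sequence (mpoly_ring n) fs"
    unfolding regular_sequence_def carrier_mpoly_ring genideal_eq[OF fs] genideal_eq[OF take]
  proof (intro conjI allI impI ballI)
    show "set fs \<subseteq> mpolys ?V" by (rule fs)
    show "g \<in> ideal_of ?V (set (take i fs))"
      if "i < length fs" "g \<in> mpolys ?V" "fs ! i \<otimes>\<^bsub>mpoly_ring n\<^esub> g \<in> ideal_of ?V (set (take i fs))" for i g
      using that pres by (simp add: ci_presentation_def nonzerodivisor_def mpoly_ring_ops)
    \<comment> \<open>The ideal is proper: the constant 1 has a nonzero part in degree 0.\<close>
    have "part {m. wt d m = 0} {} 1 = (1 :: cmpoly)"
      using part_single[of "{m. wt d m = 0}" "{}" 0 1] by simp
    then have "part {m. wt d m = 0} {} 1 \<noteq> (0 :: cmpoly)" by simp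
    then have "1 \<notin> toric (wt d) ?V" unfolding toric_def by blast
    then show "ideal_of ?V (set fs) \<noteq> mpolys ?V" unfolding toric using mpolys_one by blast
  qed
  moreover have "{p \<in> mpolys ?V. mpoly_eval ?y p = 0} = ideal_of ?V (set fs)"
    unfolding toric by (simp add: mpoly_eval_eq_0_iff toric_def)
  ultimately have "graded_complete_intersection (semigroup_algebra \<Gamma>)"
    unfolding graded_complete_intersection_def
    using image pres genideal_eq[OF fs]
    by (intro exI[of _ n] exI[of _ d] exI[of _ ?y] exI[of _ fs])
      (auto simp: carrier_mpoly_ring ci_presentation_def)
  then show ?thesis using num by (simp add: ci_semigroup_def)
qed

section \<open>Semigroups of trees\<close>

lemma add_submonoid_hull: "add_submonoid (add_submonoid hull S)"
  by (rule hull_in) (auto simp: add_submonoid_def)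

lemma add_submonoid_sum:
  "add_submonoid S \<Longrightarrow> (\<And>i. i \<in> A \<Longrightarrow> f i \<in> S) \<Longrightarrow> sum f A \<in> S"
  by (induction A rule: infinite_finite_induct) (auto simp: add_submonoid_def)

text \<open>A generator is a family with one nonzero entry. Conversely, for fixed i the numbers
  whose product with the cofactor lies in the hull form a submonoid containing \<open>X i\<close>,
  hence containing its hull.\<close>

lemma hull_eq_glue_family:
  fixes a :: "'i \<Rightarrow> nat"
  assumes "finite I"
  shows "add_submonoid hull (\<Union>z\<in>I. (\<lambda>l. (\<Prod>j\<in>I - {z}. a j) * l) ` X z) = glue_family I a (\<lambda>z. add_submonoid hull X z)"
    (is "_ hull ?U = ?F")
proof
  have zero: "0 \<in> add_submonoid hull X z" for z
    using add_submonoid_hull[of "X z"] by (simp add: add_submonoid_def)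
  show "add_submonoid hull ?U \<subseteq> ?F"
  proof (rule hull_minimal)
    show "?U \<subseteq> ?F"
    proof (rule subsetI)
      fix m assume "m \<in> ?U"
      then obtain z l where z: "z \<in> I" "l \<in> X z" and m: "m = (\<Prod>j\<in>I - {z}. a j) * l" by blast
      have "(\<Sum>i\<in>I. (\<Prod>j\<in>I - {i}. a j) * (if i = z then l else 0)) = (\<Prod>j\<in>I - {z}. a j) * l"
        using assms z by (simp add: if_distrib cong: if_cong)
      moreover have "\<forall>i\<in>I. (if i = z then l else 0) \<in> add_submonoid hull X i"
        using z zero hull_inc[of l "X z"] by auto
      ultimately show "m \<in> ?F"
        unfolding m glue_family_def by (intro CollectI exI[of _ "\<lambda>i. if i = z then l else 0"]) simp
    qed
    show "add_submonoid ?F"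
    proof (rule add_submonoidI)
      show "0 \<in> ?F" using zero by (auto simp: glue_family_def intro!: exI[of _ "\<lambda>_. 0"])
      fix m m' assume "m \<in> ?F" "m' \<in> ?F"
      then obtain g g' where
        "m = (\<Sum>i\<in>I. (\<Prod>j\<in>I - {i}. a j) * g i)" "\<forall>i\<in>I. g i \<in> add_submonoid hull X i"
        "m' = (\<Sum>i\<in>I. (\<Prod>j\<in>I - {i}. a j) * g' i)" "\<forall>i\<in>I. g' i \<in> add_submonoid hull X i"
        by (auto simp: glue_family_def)
      then have "m + m' = (\<Sum>i\<in>I. (\<Prod>j\<in>I - {i}. a j) * (g i + g' i))"
        "\<forall>i\<in>I. g i + g' i \<in> add_submonoid hull X i"
        using add_submonoid_hull by (auto simp: distrib_left sum.distrib add_submonoid_def)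
      then show "m + m' \<in> ?F"
        unfolding glue_family_def by (intro CollectI exI[of _ "\<lambda>i. g i + g' i"]) simp
    qed
  qed
  show "?F \<subseteq> add_submonoid hull ?U"
  proof
    fix m assume "m \<in> ?F"
    then obtain g where g: "m = (\<Sum>i\<in>I. (\<Prod>j\<in>I - {i}. a j) * g i)" "\<forall>i\<in>I. g i \<in> add_submonoid hull X i"
      by (auto simp: glue_family_def)
    have "(\<Prod>j\<in>I - {i}. a j) * g i \<in> add_submonoid hull ?U" if i: "i \<in> I" for i
    proof -
      let ?K = "{k. (\<Prod>j\<in>I - {i}. a j) * k \<in> add_submonoid hull ?U}"
      have "add_submonoid hull X i \<subseteq> ?K"
      proof (rule hull_minimal)
        show "X i \<subseteq> ?K" using i by (auto intro!: hull_inc)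
        show "add_submonoid ?K"
          using add_submonoid_hull[of ?U] by (auto simp: add_submonoid_def distrib_left)
      qed
      then show ?thesis using g(2) i by blast
    qed
    then show "m \<in> add_submonoid hull ?U"
      unfolding g(1) by (intro add_submonoid_sum add_submonoid_hull)
  qed
qed

lemma family_mu_cong: "(\<And>i. i \<in> I \<Longrightarrow> m i = m' i) \<Longrightarrow> family_mu I a m = family_mu I a m'"
  unfolding family_mu_def by (auto intro!: sum.cong)

context rooted_tree
begin

text \<open>The only leaf is \<open>n\<close>, and its \<open>ell\<close> is the empty product
  1.\<close>

lemma sg_no_children: "I = {} \<Longrightarrow> sg \<Delta> = UNIV"
proof -
  assume "I = {}"
  then have "sg \<Delta> = add_submonoid hull {1}" by (simp add: sg_def leaves_eq ell_n)
  moreover have "k \<in> add_submonoid hull {1}" for k :: nat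
    using add_submonoid_mult[OF add_submonoid_hull, of 1 "{1}" k] hull_inc[of 1 "{1}" add_submonoid]
    by (simp del: One_nat_def)
  ultimately show ?thesis by blast
qed

lemma sg_eq: "I \<noteq> {} \<Longrightarrow> sg \<Delta> = glue_family I a (\<lambda>z. sg (S z))"
proof -
  assume "I \<noteq> {}"
  have "ell \<Delta> ` leaves (S z) = (\<lambda>l. (\<Prod>j\<in>I - {z}. a j) * l) ` (ell (S z) ` leaves (S z))" if z: "z \<in> I" for z
    unfolding image_image using ell_S[OF z] leaves_S_subset[OF z] by (intro image_cong) auto
  then have "ell \<Delta> ` leaves \<Delta> = (\<Union>z\<in>I. (\<lambda>l. (\<Prod>j\<in>I - {z}. a j) * l) ` (ell (S z) ` leaves (S z)))"
    using \<open>I \<noteq> {}\<close> by (simp add: leaves_eq image_UN)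
  then show ?thesis unfolding sg_def by (simp add: hull_eq_glue_family[OF finite_children])
qed

end

text \<open>For the conductor it suffices to treat the number of gaps, because \<open>c(\<Gamma>) \<le> 2\<delta>(\<Gamma>)\<close>,
  together with the equality \<open>c(\<Gamma>) = \<mu>(\<Delta>)\<close> under the semigroup condition.\<close>

lemma sg_properties:
  assumes "weighted_rooted_tree \<Delta>"
  shows "numeric_semigroup (sg \<Delta>) \<and>
    int (2 * num_gaps (sg \<Delta>)) \<le> tree_mu \<Delta> \<and>
    (int (2 * num_gaps (sg \<Delta>)) = tree_mu \<Delta> \<longrightarrow>
      has_ci_presentation (sg \<Delta>) \<and> (no_valency_2 \<Delta> \<longrightarrow> semigroup_condition \<Delta>)) \<and>
    (semigroup_condition \<Delta> \<longrightarrow> int (conductor (sg \<Delta>)) = tree_mu \<Delta>)"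
  using assms
proof (induction \<Delta> rule: measure_induct_rule[of "\<lambda>\<Delta>. card (vertices \<Delta>)"])
  case (less \<Delta>)
  interpret rooted_tree \<Delta> by unfold_locales (rule less.prems)
  show ?case
  proof (cases "I = {}")
    case True
    have "conductor UNIV = 0" using conductor_le[of 0 UNIV] by simp
    then show ?thesis using True tree_mu_eq sg_no_children[OF True] has_ci_presentation_UNIV
      by (simp add: semigroup_condition_eq numeric_semigroup_def add_submonoid_def num_gaps_def family_mu_def)
  next
    case False
    note IH = less.IH[OF card_vertices_S weighted_rooted_tree_S]
    interpret coprime_family I a "\<lambda>z. sg (S z)"
      by unfold_locales (use False finite_children a_pos a_coprime IH in auto)
    let ?\<Gamma> = "glue_family I a (\<lambda>z. sg (S z))"
    let ?\<delta> = "\<lambda>z. int (2 * num_gaps (sg (S z)))"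
    have mono: "family_mu I a ?\<delta> \<le> family_mu I a (\<lambda>z. tree_mu (S z))"
      using IH by (intro family_mu_mono) auto
    have num: "numeric_semigroup ?\<Gamma>" using numeric_semigroup_subfamily[of I] False by blast
    have le: "int (2 * num_gaps ?\<Gamma>) \<le> tree_mu \<Delta>"
      using gaps_glue_family(1) mono tree_mu_eq by linarith
    have "has_ci_presentation ?\<Gamma> \<and> (no_valency_2 \<Delta> \<longrightarrow> semigroup_condition \<Delta>)"
      if eq: "int (2 * num_gaps ?\<Gamma>) = tree_mu \<Delta>"
    proof -
      \<comment> \<open>Two inequalities lead from 2\<delta>(\<Gamma>) to \<mu>(\<Delta>), and
        equality makes both sharp: the first then controls the weights, the second passes equality
        on to every branch.\<close>
      have eq1: "int (2 * num_gaps ?\<Gamma>) = family_mu I a ?\<delta>"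
        and eq2: "family_mu I a ?\<delta> = family_mu I a (\<lambda>z. tree_mu (S z))"
        using gaps_glue_family(1) mono tree_mu_eq eq by linarith+
      have sub: "?\<delta> z = tree_mu (S z)" if "z \<in> I" for z
        using IH that by (intro family_mu_mono(2)[OF _ eq2]) auto
      have mem: "a z \<in> sg (S z)" if "card I \<noteq> 1" "z \<in> I" for z
      proof -
        have "card I \<noteq> 0" using False finite_children by simp
        then show ?thesis using gaps_glue_family(2)[OF eq1] that by simp
      qed
      have "has_ci_presentation ?\<Gamma>"
      \<comment> \<open>With a single child, \<Gamma> is the semigroup of the branch and inherits
        its presentation, although nothing is known about the weight of the edge.\<close>
      proof (cases "card I = 1")
        case True
        then obtain z where "I = {z}" by (rule card_1_singletonE)
        then show ?thesis using IH[of z] sub[of z] by simp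
      next
        case False
        show ?thesis
          by (rule glue_family_closed) (use mem[OF False] IH sub has_ci_presentation_glue in auto)
      qed
      moreover have "semigroup_condition \<Delta>" if "no_valency_2 \<Delta>"
        using no_valency_2_S[OF that] mem IH sub by (simp add: semigroup_condition_eq)
      ultimately show ?thesis by blast
    qed
    moreover have "int (conductor ?\<Gamma>) = tree_mu \<Delta>" if "semigroup_condition \<Delta>"
      using that IH conductor_glue_family family_mu_cong[of I "\<lambda>z. int (conductor (sg (S z)))" "\<lambda>z. tree_mu (S z)"]
      by (simp add: semigroup_condition_eq tree_mu_eq)
    ultimately show ?thesis using num le sg_eq[OF False] by simp
  qed
qed

theorem theorem3p1:
  fixes \<Delta> :: "'a wtree"
    and \<Gamma> :: "nat set"
  assumes "weighted_rooted_tree \<Delta>"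
    and "\<Gamma> = sg \<Delta>"
  shows "numeric_semigroup \<Gamma> \<and>
    (int (2 * num_gaps \<Gamma>) \<le> tree_mu \<Delta> \<and>
     (no_valency_2 \<Delta> \<longrightarrow> (int (2 * num_gaps \<Gamma>) = tree_mu \<Delta> \<longleftrightarrow> semigroup_condition \<Delta>)) \<and>
     (semigroup_condition \<Delta> \<longrightarrow> int (2 * num_gaps \<Gamma>) = tree_mu \<Delta>) \<and>
     (int (2 * num_gaps \<Gamma>) = tree_mu \<Delta> \<longrightarrow> ci_semigroup \<Gamma>)) \<and>
    (int (conductor \<Gamma>) \<le> tree_mu \<Delta> \<and>
     (no_valency_2 \<Delta> \<longrightarrow> (int (conductor \<Gamma>) = tree_mu \<Delta> \<longleftrightarrow> semigroup_condition \<Delta>)) \<and>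
     (semigroup_condition \<Delta> \<longrightarrow> int (conductor \<Gamma>) = tree_mu \<Delta>) \<and>
     (int (conductor \<Gamma>) = tree_mu \<Delta> \<longrightarrow> ci_semigroup \<Gamma>))"
proof -
  note props = sg_properties[OF assms(1), folded assms(2)]
  have num: "numeric_semigroup \<Gamma>" and le: "int (2 * num_gaps \<Gamma>) \<le> tree_mu \<Delta>"
    and eq: "int (2 * num_gaps \<Gamma>) = tree_mu \<Delta> \<Longrightarrow>
      has_ci_presentation \<Gamma> \<and> (no_valency_2 \<Delta> \<longrightarrow> semigroup_condition \<Delta>)"
    and cond: "semigroup_condition \<Delta> \<Longrightarrow> int (conductor \<Gamma>) = tree_mu \<Delta>"
    using props by blast+
  have c_le: "int (conductor \<Gamma>) \<le> int (2 * num_gaps \<Gamma>)"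
    using conductor_le_twice_gaps[OF num] by linarith
  then have c_eq: "int (2 * num_gaps \<Gamma>) = tree_mu \<Delta>" if "int (conductor \<Gamma>) = tree_mu \<Delta>"
    using le that by linarith
  have ci: "ci_semigroup \<Gamma>" if "int (2 * num_gaps \<Gamma>) = tree_mu \<Delta>"
    using ci_semigroup_if_presentation[OF num] eq[OF that] by blast
  \<comment> \<open>Under the semigroup condition \<mu> = c \<le> 2\<delta> \<le> \<mu>, which gives
    equality for 2\<delta> as well.\<close>
  show ?thesis using num le eq cond c_le c_eq ci by (meson order_trans)
qed

end
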